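(* Let $\alpha,\beta\in\Delta$, $\alpha\neq\beta$, and let $\varphi$ be a continuous function on $\overline\Delta$ which extends holomorphically from each circle in $C_\alpha\cup C_\beta$. Then $\varphi$ is holomorphic on $\Delta$.
   Context: $\Delta$ is the open unit disc in $\mathbb C$ and $\overline\Delta$ its closure. For $\alpha\in\Delta$, $C_\alpha$ denotes the family of circles obtained as the images under the Moebius map $z\mapsto(\alpha-z)/(1-\overline\alpha z)$ of all circles in $\overline\Delta$ centered at the origin (i.e. all circles $\{|z|=R\}$, $0<R\le 1$). A continuous function on a circle $\Gamma$ extends holomorphically from $\Gamma$ if it has a continuous extension to the closed disc bounded by $\Gamma$ which is holomorphic on the open disc; a function defined on a larger set extends holomorphically from $\Gamma$ if its restriction to $\Gamma$ does. *)

theory Defs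
  imports "HOL-Complex_Analysis.Complex_Analysis"
begin

definition moebius :: "complex \<Rightarrow> complex \<Rightarrow> complex" where
  "moebius \<alpha> z = (\<alpha> - z) / (1 - cnj \<alpha> * z)"

definition circle_family :: "complex \<Rightarrow> complex set set" where
  "circle_family \<alpha> = {moebius \<alpha> ` sphere 0 R | R. 0 < R \<and> R \<le> 1}"

(* For a circle \<Gamma>, inside \<Gamma> (the union of the bounded components of the
   complement) is the open disc bounded by \<Gamma>, and \<Gamma> \<union> inside \<Gamma> the closed
   disc; see extends_holomorphically_from_sphere below. *)
definition extends_holomorphically_from :: "complex set \<Rightarrow> (complex \<Rightarrow> complex) \<Rightarrow> bool" where
  "extends_holomorphically_from \<Gamma> f \<longleftrightarrow>
     (\<exists>F. continuous_on (\<Gamma> \<union> inside \<Gamma>) F \<and> F holomorphic_on inside \<Gamma> \<and> (\<forall>z\<in>\<Gamma>. F z = f z))"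

lemma extends_holomorphically_from_sphere:
  assumes "0 < r"
  shows "extends_holomorphically_from (sphere c r) f \<longleftrightarrow>
     (\<exists>F. continuous_on (cball c r) F \<and> F holomorphic_on ball c r \<and> (\<forall>z\<in>sphere c r. F z = f z))"
proof -
  have ins: "inside (sphere c r) = ball c r"
    using inside_frontier_eq_interior[of "cball c r"] assms by simp
  have "sphere c r \<union> ball c r = cball c r"
    by auto
  with ins show ?thesis
    by (simp add: extends_holomorphically_from_def)
qed

end

theory Submission
  imports Defs
begin

text \<open>
  An extension from a circle \<open>\<Gamma>\<close> is a function of a point \<open>z\<close> in the disc bounded by \<open>\<Gamma>\<close>; the
  idea is to regard it as a function of \<open>z\<close> and of the mirror image \<open>v\<close> of \<open>z\<close> in \<open>\<Gamma>\<close>. For a fixed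
  \<open>z\<close>, let \<open>\<Gamma>\<close> run through the circles of one family that surround \<open>z\<close>, from the circle through \<open>z\<close> to the
  unit circle. Then \<open>v\<close> runs through an arc from \<open>z\<close> to \<open>1 / cnj z\<close>, and so both families provide arcs
  with the same endpoints, and functions on these arcs.

  Integrate the extension values along such an arc against \<open>k w dw\<close>, where \<open>w = cnj v\<close> and \<open>k\<close> is a
  fixed holomorphic kernel. The integrand is holomorphic in \<open>z\<close>, so the \<open>cnj z\<close>-derivative of this
  moment comes only from the endpoint \<open>w = cnj z\<close>, where the circle passes through \<open>z\<close>
  and the extension value is \<open>\<phi> z\<close>: it is \<open>- \<phi> z * k (cnj z)\<close>, whichever family is used. Hence the
  difference of the moments of the two families is holomorphic. At the unit circle the arcs shrink to
  points and the moments tend to zero, because \<open>\<phi>\<close> is continuous up to the boundary. So the difference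
  vanishes identically (\<open>moment_difference_zero\<close>).

  Normalise the centres to \<open>0\<close> and \<open>t\<close> with \<open>0 < t < 1\<close>, let \<open>z\<close> range over the upper half disc, on which the arcs
  stay in a half plane, and take as kernels the powers of the Cayley transform of \<open>w\<close>. At a point
  \<open>z\<close> between the centres the two arcs make up the whole extended real line. The equality of the moments
  and of their conjugates then says that the extension values, as a function on this circle, have no
  nonconstant Fourier coefficients. So they are constant (\<open>extension_constant_between_centres\<close>): at such a
  \<open>z\<close> all extensions from circles around \<open>0\<close> have the same value as the extension from
  the unit circle. By the identity theorem they are restrictions of that extension, and \<open>\<phi>\<close> agrees with it.

  Since \<open>\<phi>\<close> is only continuous, the moments need not be differentiable, and the derivative formula is
  replaced by its integrated form: integrals around triangles, up to an error of smaller order than the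
  squared diameter (\<open>triangle_integral_moving_endpoint\<close>). By Goursat's bisection
  argument this suffices for holomorphy (\<open>holomorphic_on_if_triangle_integrals_small\<close>).
\<close>

section \<open>Integrals around triangles\<close>

definition triangle_integral :: "(complex \<Rightarrow> complex) \<Rightarrow> complex \<Rightarrow> complex \<Rightarrow> complex \<Rightarrow> complex" where
  "triangle_integral f a b c =
     contour_integral (linepath a b) f + contour_integral (linepath b c) f + contour_integral (linepath c a) f"

lemma triangle_sides_in_hull:
  "closed_segment a b \<subseteq> convex hull {a,b,c}"
  "closed_segment b c \<subseteq> convex hull {a,b,c}"
  "closed_segment c a \<subseteq> convex hull {a,b,c}"
  using segments_subset_convex_hull by metis+

lemma triangle_sides_integrable:
  assumes "continuous_on (convex hull {a,b,c}) f"
  shows "f contour_integrable_on linepath a b" "f contour_integrable_on linepath b c"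
    "f contour_integrable_on linepath c a"
  using assms triangle_sides_in_hull
  by (meson contour_integrable_continuous_linepath continuous_on_subset)+

lemma triangle_integral_add:
  assumes "continuous_on (convex hull {a,b,c}) f" "continuous_on (convex hull {a,b,c}) g"
  shows "triangle_integral (\<lambda>z. f z + g z) a b c = triangle_integral f a b c + triangle_integral g a b c"
  unfolding triangle_integral_def
  using triangle_sides_integrable[OF assms(1)] triangle_sides_integrable[OF assms(2)]
  by (simp add: contour_integral_add)

lemma triangle_integral_diff:
  assumes "continuous_on (convex hull {a,b,c}) f" "continuous_on (convex hull {a,b,c}) g"
  shows "triangle_integral (\<lambda>z. f z - g z) a b c = triangle_integral f a b c - triangle_integral g a b c"
  unfolding triangle_integral_def
  using triangle_sides_integrable[OF assms(1)] triangle_sides_integrable[OF assms(2)]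
  by (simp add: contour_integral_diff)

lemma triangle_integral_lmul:
  assumes "continuous_on (convex hull {a,b,c}) f"
  shows "triangle_integral (\<lambda>z. k * f z) a b c = k * triangle_integral f a b c"
  unfolding triangle_integral_def
  using triangle_sides_integrable[OF assms(1)]
  by (simp add: contour_integral_lmul algebra_simps)

lemma triangle_integral_cong:
  assumes "\<And>z. z \<in> convex hull {a,b,c} \<Longrightarrow> f z = g z"
  shows "triangle_integral f a b c = triangle_integral g a b c"
proof -
  have "contour_integral (linepath x y) f = contour_integral (linepath x y) g"
    if "closed_segment x y \<subseteq> convex hull {a,b,c}" for x y
    using assms that by (intro contour_integral_cong) (auto simp: linepath_image_01 path_image_def)
  then show ?thesis
    unfolding triangle_integral_def
    using triangle_sides_in_hull[where a = a and b = b and c = c] by simp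
qed

lemma triangle_integral_holomorphic:
  assumes "f holomorphic_on S" "convex hull {a,b,c} \<subseteq> S"
  shows "triangle_integral f a b c = 0"
  using Cauchy_theorem_triangle[OF holomorphic_on_subset[OF assms]] has_chain_integral_chain_integral3
  unfolding triangle_integral_def by blast

lemma triangle_integral_bound:
  assumes "continuous_on (convex hull {a,b,c}) f" "\<And>z. z \<in> convex hull {a,b,c} \<Longrightarrow> norm (f z) \<le> B"
    and "dist a b \<le> K" "dist b c \<le> K" "dist c a \<le> K"
  shows "norm (triangle_integral f a b c) \<le> 3 * B * K"
proof -
  have B: "0 \<le> B"
    using assms(2)[of a] by (meson hull_inc insertI1 norm_ge_zero order_trans)
  have *: "norm (contour_integral (linepath x y) f) \<le> B * K"
    if "closed_segment x y \<subseteq> convex hull {a,b,c}" "dist x y \<le> K" "f contour_integrable_on linepath x y" for x y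
  proof -
    have "norm (contour_integral (linepath x y) f) \<le> B * norm (y - x)"
      using that assms(2) B by (intro contour_integral_bound_linepath) auto
    also have "\<dots> \<le> B * K"
      using that(2) B by (intro mult_left_mono) (auto simp: dist_norm norm_minus_commute)
    finally show ?thesis .
  qed
  have "norm (triangle_integral f a b c) \<le> norm (contour_integral (linepath a b) f)
     + norm (contour_integral (linepath b c) f) + norm (contour_integral (linepath c a) f)"
    unfolding triangle_integral_def by (meson norm_triangle_ineq norm_add_rule_thm order_trans add_right_mono order_refl)
  also have "\<dots> \<le> B * K + B * K + B * K"
    using triangle_sides_integrable[OF assms(1)] assms(3-5)
      triangle_sides_in_hull[where a = a and b = b and c = c]
    by (intro add_mono *)
  finally show ?thesis by simp
qed

lemma triangle_diameter:
  fixes a b c :: complex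
  assumes "dist a b \<le> K" "dist b c \<le> K" "dist c a \<le> K" "x \<in> convex hull {a,b,c}" "y \<in> convex hull {a,b,c}"
  shows "dist x y \<le> K"
  using triangle_points_closer[OF assms(4,5)] assms(1-3) by (auto simp: dist_norm)

text \<open>Goursat's bisection argument, with the differentiability hypothesis replaced by what it is used
  for. A triangle whose integral is nonzero contains a nested sequence of triangles whose integrals
  decay no faster than the squares of their diameters; at the common point of these triangles the
  hypothesis says that the integrals do decay faster. Morera's theorem concludes.\<close>

lemma holomorphic_on_if_triangle_integrals_small:
  assumes "open U" and contf: "continuous_on U f"
    and small: "\<And>z e. z \<in> U \<Longrightarrow> 0 < e \<Longrightarrow> \<exists>d>0. \<forall>a b c K. z \<in> convex hull {a,b,c} \<longrightarrow>
       dist a b \<le> K \<longrightarrow> dist b c \<le> K \<longrightarrow> dist c a \<le> K \<longrightarrow> K \<le> d \<longrightarrow>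
       norm (triangle_integral f a b c) \<le> e * K\<^sup>2"
  shows "f holomorphic_on U"
proof -
  have "triangle_integral f a b c = 0" if sub: "convex hull {a,b,c} \<subseteq> U" for a b c
  proof (rule ccontr)
    assume nz: "triangle_integral f a b c \<noteq> 0"
    define K where "K = 1 + max (dist a b) (max (dist b c) (dist c a))"
    define e where "e = norm (triangle_integral f a b c) / K\<^sup>2"
    have K1: "K \<ge> 1"  by (simp add: K_def max.coboundedI1)
    then have K: "K > 0" by linarith
    have e: "e > 0"
      unfolding e_def using nz K by simp
    define At where "At x y z n \<longleftrightarrow>
        convex hull {x,y,z} \<subseteq> convex hull {a,b,c} \<and>
        dist x y \<le> K/2^n \<and> dist y z \<le> K/2^n \<and> dist z x \<le> K/2^n \<and>
        norm (triangle_integral f x y z) \<ge> e*(K/2^n)^2"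
      for x y z n
    have At0: "At a b c 0"
      using K1 by (auto simp: At_def e_def K_def)
    have AtSuc: "\<exists>x' y' z'. At x' y' z' (Suc n) \<and> convex hull {x',y',z'} \<subseteq> convex hull {x,y,z}"
      if At: "At x y z n" for x y z n
    proof -
      have contf': "continuous_on (convex hull {x,y,z}) f"
        using At contf sub unfolding At_def by (meson continuous_on_subset)
      show ?thesis
        using At Cauchy_theorem_quadrisection [OF contf', of "K/2^n" e]
        apply (simp add: At_def triangle_integral_def algebra_simps)
        apply (meson convex_hull_subset empty_subsetI insert_subset subsetCE)
        done
    qed
    obtain fa fb fc
      where f0 [simp]: "fa 0 = a" "fb 0 = b" "fc 0 = c"
        and cosb: "\<And>n. convex hull {fa n, fb n, fc n} \<subseteq> convex hull {a,b,c}"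
        and dist: "\<And>n. dist (fa n) (fb n) \<le> K/2^n"
                  "\<And>n. dist (fb n) (fc n) \<le> K/2^n"
                  "\<And>n. dist (fc n) (fa n) \<le> K/2^n"
        and no: "\<And>n. norm (triangle_integral f (fa n) (fb n) (fc n)) \<ge> e * (K/2^n)^2"
        and conv_le: "\<And>n. convex hull {fa(Suc n), fb(Suc n), fc(Suc n)} \<subseteq> convex hull {fa n, fb n, fc n}"
      by (rule Chain3 [of At, OF At0 AtSuc]) (auto simp: At_def)
    obtain x where x: "\<And>n. x \<in> convex hull {fa n, fb n, fc n}"
    proof (rule bounded_closed_nest)
      show "\<And>n. closed (convex hull {fa n, fb n, fc n})"
        by (simp add: compact_imp_closed finite_imp_compact_convex_hull)
      show "\<And>m n. m \<le> n \<Longrightarrow> convex hull {fa n, fb n, fc n} \<subseteq> convex hull {fa m, fb m, fc m}"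
        by (erule transitive_stepwise_le) (auto simp: conv_le)
    qed (fastforce intro: finite_imp_bounded_convex_hull)+
    have "x \<in> U" using x[of 0] sub by auto
    then obtain d where "d > 0" and d: "\<And>a b c K. x \<in> convex hull {a,b,c} \<Longrightarrow>
       dist a b \<le> K \<Longrightarrow> dist b c \<le> K \<Longrightarrow> dist c a \<le> K \<Longrightarrow> K \<le> d \<Longrightarrow>
       norm (triangle_integral f a b c) \<le> e/2 * K\<^sup>2"
      using small[of x "e/2"] e by fastforce
    obtain n where "K / d < 2 ^ n"
      using real_arch_pow[of 2 "K/d"] by auto
    then have n: "K / 2^n \<le> d"
      using \<open>d > 0\<close> by (simp add: field_simps less_imp_le)
    have "e * (K/2^n)^2 \<le> e/2 * (K/2^n)^2"
      using order_trans[OF no[of n] d[OF x dist n]] .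
    then show False
      using e K by simp
  qed
  then have "f analytic_on U"
    using \<open>open U\<close> contf unfolding triangle_integral_def
    by (intro Morera_triangle) auto
  then show ?thesis
    by (rule analytic_imp_holomorphic)
qed

section \<open>Integrals with a moving endpoint\<close>

text \<open>An affine substitution moves the variable endpoint into the integrand, which turns the claim into
  the continuity of an integral over a fixed interval.\<close>

lemma continuous_on_integral_moving_endpoint:
  fixes P :: "real \<Rightarrow> complex \<Rightarrow> complex" and q :: "complex \<Rightarrow> real"
  assumes contq: "continuous_on D q" and q1: "\<And>z. z \<in> D \<Longrightarrow> q z \<le> 1"
    and contP: "continuous_on {(s,z). z \<in> D \<and> q z \<le> s \<and> s \<le> 1} (\<lambda>(s,z). P s z)"
  shows "continuous_on D (\<lambda>z. integral {q z..1} (\<lambda>s. P s z))"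
proof -
  have "continuous_on D (\<lambda>z. integral (cbox 0 1) (\<lambda>x. P (q z + (1 - q z) * x) z))"
  proof (rule integral_continuous_on_param)
    have mem: "0 \<le> (1 - q z) * x \<and> q z + (1 - q z) * x \<le> 1"
      if "z \<in> D" "0 \<le> x" "x \<le> 1" for z x
    proof -
      have "(1 - q z) * x \<le> (1 - q z) * 1"
        using q1[OF that(1)] that by (intro mult_left_mono) auto
      moreover have "0 \<le> (1 - q z) * x"
        using q1[OF that(1)] that by simp
      ultimately show ?thesis by simp
    qed
    have "continuous_on (D \<times> {0..1}) ((\<lambda>(s,z). P s z) \<circ> (\<lambda>(z,x). (q z + (1 - q z) * x, z)))"
      by (intro continuous_on_compose continuous_on_subset[OF contP])
         (auto simp: case_prod_unfold mem intro!: continuous_intros continuous_on_compose2[OF contq])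
    then show "continuous_on (D \<times> cbox 0 1) (\<lambda>(z,x). P (q z + (1 - q z) * x) z)"
      by (simp add: o_def case_prod_unfold)
  qed
  then have *: "continuous_on D (\<lambda>z. of_real (1 - q z) * integral (cbox 0 1) (\<lambda>x. P (q z + (1 - q z) * x) z))"
    by (intro continuous_intros contq)
  show ?thesis
  proof (rule continuous_on_eq[OF *])
    fix z assume z: "z \<in> D"
    show "of_real (1 - q z) * integral (cbox 0 1) (\<lambda>x. P (q z + (1 - q z) * x) z) = integral {q z..1} (\<lambda>s. P s z)"
    proof (cases "q z = 1")
      case False
      then have m: "1 - q z > 0" using q1[OF z] by simp
      have "continuous_on {q z..1} ((\<lambda>(s,z). P s z) \<circ> (\<lambda>s. (s, z)))"
        using z by (intro continuous_on_compose continuous_on_subset[OF contP]) (auto intro!: continuous_intros)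
      then have "(\<lambda>s. P s z) integrable_on cbox (q z) 1"
        by (intro integrable_continuous) (simp add: o_def)
      then have "((\<lambda>s. P s z) has_integral integral {q z..1} (\<lambda>s. P s z)) (cbox (q z) 1)"
        by (simp add: integrable_integral)
      from has_integral_affinity'[OF this m, of "q z"]
      have "integral (cbox 0 1) (\<lambda>x. P (q z + (1 - q z) * x) z) = integral {q z..1} (\<lambda>s. P s z) /\<^sub>R (1 - q z)"
        using m by (simp add: add.commute integral_unique)
      then show ?thesis using m by (simp add: scaleR_conv_of_real)
    qed simp
  qed
qed

text \<open>Fubini's theorem on each side of the triangle.\<close>

lemma triangle_integral_of_parametric_integral:
  fixes P :: "real \<Rightarrow> complex \<Rightarrow> complex"
  assumes contP: "continuous_on ({r..1} \<times> (convex hull {a,b,c})) (\<lambda>(s,z). P s z)"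
    and zero: "\<And>s. s \<in> {r..1} \<Longrightarrow> triangle_integral (P s) a b c = 0"
  shows "triangle_integral (\<lambda>z. integral {r..1} (\<lambda>s. P s z)) a b c = 0"
proof -
  have side: "contour_integral (linepath x y) (\<lambda>z. integral {r..1} (\<lambda>s. P s z))
       = integral {r..1} (\<lambda>s. contour_integral (linepath x y) (P s))"
    and side_integrable: "(\<lambda>s. contour_integral (linepath x y) (P s)) integrable_on {r..1}"
    if sub: "closed_segment x y \<subseteq> convex hull {a,b,c}" for x y
  proof -
    have mem: "linepath x y t \<in> convex hull {a,b,c}" if "0 \<le> t" "t \<le> 1" for t
      using sub that by (meson atLeastAtMost_iff linepath_in_path subsetD)
    have 1: "continuous_on ({r..1} \<times> {0..1}) ((\<lambda>(s,z). P s z) \<circ> (\<lambda>(s,t). (s, linepath x y t)))"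
      unfolding case_prod_unfold
      by (intro continuous_on_compose continuous_on_subset[OF contP[unfolded case_prod_unfold]])
         (auto simp: mem linepath_def intro!: continuous_intros mem[unfolded linepath_def])
    then have 2: "continuous_on ({r..1} \<times> {0..1}) (\<lambda>(s,t). P s (linepath x y t) * (y - x))"
      by (auto simp: o_def case_prod_unfold intro!: continuous_intros)
    have sw: "continuous_on ({0..1} \<times> {r..1}) ((\<lambda>(s,t). P s (linepath x y t) * (y - x)) \<circ> (\<lambda>(t,s). (s,t)))"
      unfolding case_prod_unfold
      by (intro continuous_on_compose continuous_on_subset[OF 2[unfolded case_prod_unfold]])
         (auto intro!: continuous_intros)
    have "contour_integral (linepath x y) (\<lambda>z. integral {r..1} (\<lambda>s. P s z))
       = integral {0..1} (\<lambda>t. integral {r..1} (\<lambda>s. P s (linepath x y t)) * (y - x))"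
      by (simp add: contour_integral_integral)
    also have "\<dots> = integral {0..1} (\<lambda>t. integral {r..1} (\<lambda>s. P s (linepath x y t) * (y - x)))"
      by simp
    also have "\<dots> = integral {r..1} (\<lambda>s. integral {0..1} (\<lambda>t. P s (linepath x y t) * (y - x)))"
      using integral_swap_continuous[of 0 r 1 1 "\<lambda>t s. P s (linepath x y t) * (y - x)"] sw
      by (simp add: o_def case_prod_unfold cbox_Pair_eq)
    finally show "contour_integral (linepath x y) (\<lambda>z. integral {r..1} (\<lambda>s. P s z))
       = integral {r..1} (\<lambda>s. contour_integral (linepath x y) (P s))"
      by (simp add: contour_integral_integral)
    have "continuous_on {r..1} (\<lambda>s. integral (cbox 0 1) (\<lambda>t. P s (linepath x y t) * (y - x)))"
      using 2 by (intro integral_continuous_on_param) simp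
    then show "(\<lambda>s. contour_integral (linepath x y) (P s)) integrable_on {r..1}"
      by (simp add: contour_integral_integral integrable_continuous_real)
  qed
  note sides = triangle_sides_in_hull[where a = a and b = b and c = c]
  have "triangle_integral (\<lambda>z. integral {r..1} (\<lambda>s. P s z)) a b c
      = integral {r..1} (\<lambda>s. triangle_integral (P s) a b c)"
    unfolding triangle_integral_def
    using sides by (simp add: side side_integrable integral_add integrable_add)
  also have "\<dots> = integral {r..1} (\<lambda>s. 0)"
    using zero by (intro integral_cong) auto
  finally show ?thesis by simp
qed

text \<open>The weak form of the formula
  \<open>\<partial>/\<partial>(cnj z) (integral {q z..1} (P _ z)) = - P (q z) z * \<partial>q/\<partial>(cnj z)\<close>
  for an integrand that is holomorphic in \<open>z\<close>: here \<open>l\<close> is the derivative of \<open>q\<close> with respect to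
  \<open>cnj z\<close>. Since \<open>P\<close> is only continuous on the closed region \<open>q z \<le> s\<close>, the integral
  has no derivative in general; but up to an error that is small compared with the square of the
  diameter, its integral around a small triangle is that of a constant multiple of \<open>cnj\<close>, and
  such triangle integrals are all that the Goursat argument needs.\<close>

lemma triangle_integral_moving_endpoint:
  fixes P :: "real \<Rightarrow> complex \<Rightarrow> complex" and q :: "complex \<Rightarrow> real"
  assumes "open U" "z0 \<in> U" and contq: "continuous_on U q" and q1: "\<And>z. z \<in> U \<Longrightarrow> q z < 1"
    and contP: "continuous_on {(s,z). z \<in> U \<and> q z \<le> s \<and> s \<le> 1} (\<lambda>(s,z). P s z)"
    and holP: "\<And>s. s \<le> 1 \<Longrightarrow> P s holomorphic_on {z \<in> U. q z < s}"
    and der: "(q has_derivative (\<lambda>h. 2 * Re (l * cnj h))) (at z0)"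
    and "0 < e"
  shows "\<exists>d>0. \<forall>a b c K. z0 \<in> convex hull {a,b,c} \<longrightarrow>
       dist a b \<le> K \<longrightarrow> dist b c \<le> K \<longrightarrow> dist c a \<le> K \<longrightarrow> K \<le> d \<longrightarrow>
       norm (triangle_integral (\<lambda>z. integral {q z..1} (\<lambda>s. P s z)) a b c
             + P (q z0) z0 * l * triangle_integral cnj a b c) \<le> e * K\<^sup>2"
proof -
  define P0 where "P0 = P (q z0) z0"
  \<comment> \<open>a Lipschitz constant of \<open>q\<close> at \<open>z0\<close>\<close>
  define C where "C = 2 * norm l + 1"
  have "C > 0" by (simp add: C_def add_nonneg_pos)
  define e1 where "e1 = e / (6 * (2 * C + 1))"
  define e2 where "e2 = min 1 (e / (6 * (norm P0 + 1)))"
  have "e1 > 0" "e2 > 0"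
    using \<open>e > 0\<close> \<open>C > 0\<close> by (auto simp: e1_def e2_def intro!: divide_pos_pos add_nonneg_pos)
  obtain d1 where "d1 > 0" and d1: "cball z0 d1 \<subseteq> U"
    using \<open>open U\<close> \<open>z0 \<in> U\<close> open_contains_cball by blast
  obtain d2 where "d2 > 0" and d2: "\<And>z. norm (z - z0) < d2 \<Longrightarrow>
       \<bar>q z - q z0 - 2 * Re (l * cnj (z - z0))\<bar> \<le> e2 * norm (z - z0)"
    using der \<open>e2 > 0\<close> unfolding has_derivative_at_alt by fastforce
  have "(q z0, z0) \<in> {(s,z). z \<in> U \<and> q z \<le> s \<and> s \<le> 1}"
    using \<open>z0 \<in> U\<close> q1[of z0] by auto
  then obtain d3 where "d3 > 0" and d3: "\<And>s z. z \<in> U \<Longrightarrow> q z \<le> s \<Longrightarrow> s \<le> 1 \<Longrightarrow>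
      dist (s,z) (q z0, z0) < d3 \<Longrightarrow> dist (P s z) P0 < e1"
    using contP \<open>e1 > 0\<close> unfolding continuous_on_iff P0_def by fastforce
  define d where "d = min (min (d1/2) (d2/2)) (min ((1 - q z0) / (2 * (C + 1))) (d3 / (2 * (C + 3))))"
  have "d > 0"
    using \<open>d1 > 0\<close> \<open>d2 > 0\<close> \<open>d3 > 0\<close> \<open>C > 0\<close> q1[OF \<open>z0 \<in> U\<close>] by (simp add: d_def)
  have dd: "d < d1" "d < d2"
    using \<open>d1 > 0\<close> \<open>d2 > 0\<close> by (auto simp: d_def)
  have "d \<le> (1 - q z0) / (2 * (C + 1))" "d \<le> d3 / (2 * (C + 3))"
    by (auto simp: d_def)
  then have "d * (2 * (C + 1)) \<le> 1 - q z0" "d * (2 * (C + 3)) \<le> d3"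
    using \<open>C > 0\<close> by (auto simp: pos_le_divide_eq)
  moreover have "0 < C * d" using \<open>d > 0\<close> \<open>C > 0\<close> by simp
  ultimately have dC: "(C + 1) * d \<le> 1 - q z0" "(C + 3) * d < d3"
    using \<open>d > 0\<close> by (auto simp: algebra_simps)
  let ?A = "\<lambda>z. integral {q z..1} (\<lambda>s. P s z)"
  have contA: "continuous_on U ?A"
    using q1 contP by (intro continuous_on_integral_moving_endpoint contq) (auto simp: less_imp_le)
  have "norm (triangle_integral ?A a b c + P (q z0) z0 * l * triangle_integral cnj a b c) \<le> e * K\<^sup>2"
    if z0: "z0 \<in> convex hull {a,b,c}" and dist: "dist a b \<le> K" "dist b c \<le> K" "dist c a \<le> K" and "K \<le> d"
    for a b c K
  proof (cases "K = 0")
    case True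
    with dist show ?thesis by (simp add: triangle_integral_def)
  next
    case False
    moreover have "K \<ge> 0" using dist(1) by (meson order_trans zero_le_dist)
    ultimately have "K > 0" by simp
    let ?T = "convex hull {a,b,c}"
    have near: "norm (z - z0) \<le> K" if "z \<in> ?T" for z
      using triangle_diameter[OF dist that z0] by (simp add: dist_norm)
    have TU: "?T \<subseteq> U"
      using near dd \<open>K \<le> d\<close> d1 by (force simp: dist_norm norm_minus_commute)
    \<comment> \<open>above all values of \<open>q\<close> on the triangle, so that the part of the integral over \<open>{r..1}\<close> is holomorphic there\<close>
    define r where "r = q z0 + (C + 1) * K"
    have "(C + 1) * K \<le> (C + 1) * d" 
      using \<open>K \<le> d\<close> \<open>C > 0\<close> by (intro mult_left_mono) auto
    then have r1: "r \<le> 1" and "r \<le> q z0 + (C + 1) * d" using dC by (auto simp: r_def)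
    have qd: "\<bar>q z - q z0 - 2 * Re (l * cnj (z - z0))\<bar> \<le> e2 * K" if "z \<in> ?T" for z
    proof -
      have "norm (z - z0) < d2" using near[OF that] dd \<open>K \<le> d\<close> by linarith
      moreover have "e2 * norm (z - z0) \<le> e2 * K" using near[OF that] \<open>e2 > 0\<close> by simp
      ultimately show ?thesis using d2 by (meson order_trans)
    qed
    have qC: "\<bar>q z - q z0\<bar> \<le> C * K" if "z \<in> ?T" for z
    proof -
      have "\<bar>Re (l * cnj (z - z0))\<bar> \<le> norm l * norm (z - z0)"
        by (metis abs_Re_le_cmod complex_mod_cnj norm_mult)
      also have "\<dots> \<le> norm l * K" using near[OF that] by (intro mult_left_mono) auto
      finally have "\<bar>2 * Re (l * cnj (z - z0))\<bar> \<le> 2 * norm l * K" by simp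
      moreover have "e2 * K \<le> 1 * K" using \<open>K > 0\<close> unfolding e2_def by (intro mult_right_mono) auto
      ultimately show ?thesis using qd[OF that] unfolding C_def by (simp add: algebra_simps)
    qed
    have qr: "q z < r" "r - q z \<le> (2 * C + 1) * K" if "z \<in> ?T" for z
      using qC[OF that] \<open>K > 0\<close> unfolding r_def by (auto simp: algebra_simps)
    let ?H = "\<lambda>z. integral {r..1} (\<lambda>s. P s z)"
    have qs: "q z \<le> s" if "z \<in> ?T" "r \<le> s" for s z
      using qr(1)[OF that(1)] that(2) by linarith
    have contP': "continuous_on ({r..1} \<times> ?T) (\<lambda>(s,z). P s z)"
      using TU qs by (intro continuous_on_subset[OF contP]) auto
    have tri_H: "triangle_integral ?H a b c = 0"
    proof (rule triangle_integral_of_parametric_integral[OF contP'])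
      fix s assume "s \<in> {r..1}"
      then show "triangle_integral (P s) a b c = 0"
        using TU qr(1) by (intro triangle_integral_holomorphic[OF holP[of s]]) force+
    qed
    have contH: "continuous_on ?T ?H"
    proof -
      have "continuous_on (?T \<times> {r..1}) ((\<lambda>(s,z). P s z) \<circ> prod.swap)"
        by (intro continuous_on_compose continuous_on_swap continuous_on_subset[OF contP']) auto
      then have "continuous_on ?T (\<lambda>z. integral (cbox r 1) (\<lambda>s. P s z))"
        by (intro integral_continuous_on_param) (simp add: o_def case_prod_unfold)
      then show ?thesis by simp
    qed
    \<comment> \<open>the holomorphic affine part that appears when \<open>P\<close> is replaced by \<open>P0\<close> and \<open>q\<close> by its linearisation\<close>
    let ?L = "\<lambda>z. P0 * of_real (r - q z0) - P0 * cnj l * (z - z0) + P0 * l * cnj z0"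
    define E where "E z = ?A z + P0 * l * cnj z - ?H z - ?L z" for z
    have contA': "continuous_on ?T ?A" using contA TU continuous_on_subset by blast
    have contE: "continuous_on ?T E"
      unfolding E_def by (intro continuous_intros contA' contH)
    have E_le: "norm (E z) \<le> e / 3 * K" if z: "z \<in> ?T" for z
    proof -
      have "z \<in> U" using z TU by auto
      have cont: "continuous_on {q z..1} (\<lambda>s. P s z)"
      proof -
        have "continuous_on {q z..1} ((\<lambda>(s,z). P s z) \<circ> (\<lambda>s. (s, z)))"
          using \<open>z \<in> U\<close> by (intro continuous_on_compose continuous_on_subset[OF contP]) (auto intro!: continuous_intros)
        then show ?thesis by (simp add: o_def)
      qed
      have split: "?A z = integral {q z..r} (\<lambda>s. P s z) + ?H z"
        using Henstock_Kurzweil_Integration.integral_combine[OF less_imp_le[OF qr(1)[OF z]] r1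
            integrable_continuous_real[OF cont]] by simp
      have "norm (integral (cbox (q z) r) (\<lambda>s. P s z - P0)) \<le> e1 * measure lborel (cbox (q z) r)"
      proof (rule integrable_bound)
        show "(\<lambda>s. P s z - P0) integrable_on cbox (q z) r"
          using r1 by (auto intro!: integrable_continuous_real continuous_intros continuous_on_subset[OF cont])
        fix s assume s: "s \<in> cbox (q z) r"
        have "dist (s,z) (q z0, z0) \<le> \<bar>s - q z0\<bar> + dist z z0"
          using sqrt_sum_squares_le_sum_abs[of "dist s (q z0)" "dist z z0"]
          by (simp add: dist_Pair_Pair dist_real_def)
        also have "\<dots> \<le> (C + 1) * K + K"
          using s qC[OF z] near[OF z] \<open>K > 0\<close> unfolding r_def
          by (auto simp: dist_norm abs_le_iff algebra_simps)
        also have "\<dots> \<le> (C + 3) * d"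
          using \<open>K \<le> d\<close> \<open>(C + 1) * K \<le> (C + 1) * d\<close> \<open>d > 0\<close> by (simp add: algebra_simps)
        also have "\<dots> < d3" by (rule dC)
        finally show "norm (P s z - P0) \<le> e1"
          using d3[of z s] s r1 \<open>z \<in> U\<close> by (auto simp: dist_norm less_imp_le)
      qed (use \<open>e1 > 0\<close> in auto)
      moreover have "integral {q z..r} (\<lambda>s. P s z - P0) = integral {q z..r} (\<lambda>s. P s z) - of_real (r - q z) * P0"
        using qr(1)[OF z] r1
        by (subst integral_diff)
           (auto intro!: integrable_continuous_real continuous_on_subset[OF cont] simp: scaleR_conv_of_real)
      ultimately have 1: "norm (integral {q z..r} (\<lambda>s. P s z) - of_real (r - q z) * P0) \<le> e1 * (r - q z)"
        using qr(1)[OF z] by simp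
      have "e1 * (r - q z) \<le> e1 * ((2 * C + 1) * K)"
        using qr(2)[OF z] \<open>e1 > 0\<close> by simp
      also have "\<dots> = e / 6 * K" using \<open>C > 0\<close> unfolding e1_def by (simp add: field_simps)
      finally have 1: "norm (integral {q z..r} (\<lambda>s. P s z) - of_real (r - q z) * P0) \<le> e / 6 * K"
        using 1 by linarith
      have id: "E z = (integral {q z..r} (\<lambda>s. P s z) - of_real (r - q z) * P0)
           - P0 * of_real (q z - q z0 - 2 * Re (l * cnj (z - z0)))"
      proof -
        have rr: "complex_of_real (2 * Re (l * cnj (z - z0))) = l * cnj (z - z0) + cnj l * (z - z0)"
          using complex_add_cnj[of "l * cnj (z - z0)"] by simp
        show ?thesis
          unfolding E_def split of_real_diff rr by (simp add: algebra_simps)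
      qed
      have "norm (P0 * of_real (q z - q z0 - 2 * Re (l * cnj (z - z0)))) \<le> norm P0 * (e2 * K)"
        unfolding norm_mult norm_of_real using qd[OF z] by (intro mult_left_mono) auto
      also have "\<dots> \<le> (norm P0 + 1) * (e / (6 * (norm P0 + 1)) * K)"
        using \<open>K > 0\<close> \<open>e > 0\<close> \<open>e2 > 0\<close> by (intro mult_mono) (auto simp: e2_def)
      also have "\<dots> = e / 6 * K" by (simp add: field_simps add_nonneg_eq_0_iff)
      finally have 2: "norm (P0 * of_real (q z - q z0 - 2 * Re (l * cnj (z - z0)))) \<le> e / 6 * K" .
      have "norm (E z) \<le> e / 6 * K + e / 6 * K"
        unfolding id using norm_triangle_ineq4 1 2 by (meson add_mono order_trans)
      then show ?thesis by (simp add: field_simps)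
    qed
    have "triangle_integral ?A a b c + P0 * l * triangle_integral cnj a b c
        = triangle_integral (\<lambda>z. ?A z + P0 * l * cnj z) a b c"
      by (subst triangle_integral_add)
         (auto intro!: continuous_intros contA' simp: triangle_integral_lmul)
    also have "\<dots> = triangle_integral (\<lambda>z. (?H z + ?L z) + E z) a b c"
      by (intro triangle_integral_cong) (simp add: E_def)
    also have "\<dots> = triangle_integral (\<lambda>z. ?H z + ?L z) a b c + triangle_integral E a b c"
      by (intro triangle_integral_add contE continuous_intros contH)
    also have "triangle_integral (\<lambda>z. ?H z + ?L z) a b c = triangle_integral ?H a b c + triangle_integral ?L a b c"
      by (intro triangle_integral_add continuous_intros contH)
    also have "triangle_integral ?L a b c = 0"
      by (rule triangle_integral_holomorphic[where S = UNIV]) (auto intro!: holomorphic_intros)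
    finally have "norm (triangle_integral ?A a b c + P0 * l * triangle_integral cnj a b c)
        = norm (triangle_integral E a b c)" by (simp add: tri_H)
    also have "\<dots> \<le> 3 * (e / 3 * K) * K"
      by (rule triangle_integral_bound[OF contE E_le dist])
    finally show ?thesis by (simp add: P0_def power2_eq_square)
  qed
  with \<open>d > 0\<close> show ?thesis by blast
qed

section \<open>Moebius involutions of the disc\<close>

lemma moebius_denominator_nonzero:
  assumes "norm \<gamma> < 1" "norm z \<le> 1"
  shows "1 - cnj \<gamma> * z \<noteq> 0"
proof -
  have "norm (cnj \<gamma> * z) < 1"
    using assms by (metis complex_mod_cnj mult_left_le norm_ge_zero norm_mult order_le_less_trans)
  then show ?thesis by auto
qed

text \<open>The identity from which all mapping properties of \<open>moebius \<gamma>\<close> on the disc are read off.\<close>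

lemma norm_moebius:
  assumes "norm \<gamma> < 1" "norm z \<le> 1"
  shows "1 - (norm (moebius \<gamma> z))\<^sup>2 = (1 - (norm \<gamma>)\<^sup>2) * (1 - (norm z)\<^sup>2) / (norm (1 - cnj \<gamma> * z))\<^sup>2"
proof -
  have "(norm (1 - cnj \<gamma> * z))\<^sup>2 - (norm (\<gamma> - z))\<^sup>2 = (1 - (norm \<gamma>)\<^sup>2) * (1 - (norm z)\<^sup>2)"
    unfolding cmod_power2 by (simp add: power2_eq_square algebra_simps)
  moreover have "norm (1 - cnj \<gamma> * z) \<noteq> 0"
    using moebius_denominator_nonzero[OF assms] by simp
  ultimately show ?thesis
    by (simp add: moebius_def norm_divide power_divide field_simps)
qed

lemma norm_moebius_le_1:
  assumes "norm \<gamma> < 1" "norm z \<le> 1"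
  shows "norm (moebius \<gamma> z) \<le> 1"
proof -
  have "0 \<le> (1 - (norm \<gamma>)\<^sup>2) * (1 - (norm z)\<^sup>2) / (norm (1 - cnj \<gamma> * z))\<^sup>2"
    using assms by (intro divide_nonneg_nonneg mult_nonneg_nonneg) (auto simp: power_le_one)
  then have "(norm (moebius \<gamma> z))\<^sup>2 \<le> 1" using norm_moebius[OF assms] by linarith
  then show ?thesis by (simp add: power2_le_iff_abs_le abs_square_le_1)
qed

lemma norm_moebius_less_1_iff:
  assumes "norm \<gamma> < 1" "norm z \<le> 1"
  shows "norm (moebius \<gamma> z) < 1 \<longleftrightarrow> norm z < 1"
proof -
  have pos: "0 < 1 - (norm \<gamma>)\<^sup>2" using assms by (simp add: power_less_one_iff abs_square_less_1)
  have "(norm (1 - cnj \<gamma> * z))\<^sup>2 > 0" using moebius_denominator_nonzero[OF assms] by simp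
  then have "0 < 1 - (norm (moebius \<gamma> z))\<^sup>2 \<longleftrightarrow> 0 < 1 - (norm z)\<^sup>2"
    unfolding norm_moebius[OF assms] using pos by (simp add: zero_less_divide_iff zero_less_mult_iff)
  then show ?thesis by (simp add: abs_square_less_1)
qed

lemma continuous_on_moebius:
  "norm \<gamma> < 1 \<Longrightarrow> continuous_on (cball 0 1) (moebius \<gamma>)"
  unfolding moebius_def using moebius_denominator_nonzero by (auto intro!: continuous_intros)

lemma holomorphic_on_moebius:
  "norm \<gamma> < 1 \<Longrightarrow> moebius \<gamma> holomorphic_on ball 0 1"
  unfolding moebius_def using moebius_denominator_nonzero by (auto intro!: holomorphic_intros simp: less_imp_le)

lemma moebius_eq_0_iff:
  assumes "norm \<gamma> < 1" "norm z \<le> 1"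
  shows "moebius \<gamma> z = 0 \<longleftrightarrow> z = \<gamma>"
  using moebius_denominator_nonzero[OF assms] by (auto simp: moebius_def)

lemma moebius_has_field_derivative:
  assumes "norm \<gamma> < 1" "norm z \<le> 1"
  shows "(moebius \<gamma> has_field_derivative (\<gamma> * cnj \<gamma> - 1) / (1 - cnj \<gamma> * z)\<^sup>2) (at z)"
  unfolding moebius_def using moebius_denominator_nonzero[OF assms]
  by (auto intro!: derivative_eq_intros simp: algebra_simps power2_eq_square)

lemma moebius_involution:
  assumes "norm \<gamma> < 1" "norm z \<le> 1"
  shows "moebius \<gamma> (moebius \<gamma> z) = z"
proof -
  define d where "d = 1 - cnj \<gamma> * z"
  have d: "d \<noteq> 0" unfolding d_def by (rule moebius_denominator_nonzero[OF assms])
  have \<gamma>: "1 - cnj \<gamma> * \<gamma> \<noteq> 0" using moebius_denominator_nonzero[of \<gamma> \<gamma>] assms by simp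
  have "\<gamma> - (\<gamma> - z) / d = z * (1 - cnj \<gamma> * \<gamma>) / d" "1 - cnj \<gamma> * ((\<gamma> - z) / d) = (1 - cnj \<gamma> * \<gamma>) / d"
    using d by (simp_all add: field_simps) (simp_all add: d_def algebra_simps)
  then show ?thesis
    using d \<gamma> by (simp add: moebius_def d_def[symmetric])
qed

lemma Im_moebius_of_real:
  "Im (moebius (of_real \<gamma>) z) = - ((1 - \<gamma>\<^sup>2) * Im z / (norm (1 - of_real \<gamma> * z))\<^sup>2)"
proof -
  have "Im (moebius (of_real \<gamma>) z) = (Im (of_real \<gamma> - z) * Re (1 - of_real \<gamma> * z)
      - Re (of_real \<gamma> - z) * Im (1 - of_real \<gamma> * z)) / (norm (1 - of_real \<gamma> * z))\<^sup>2"
    by (simp add: moebius_def Im_divide cmod_power2)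
  also have "Im (of_real \<gamma> - z) * Re (1 - of_real \<gamma> * z) - Re (of_real \<gamma> - z) * Im (1 - of_real \<gamma> * z)
      = - ((1 - \<gamma>\<^sup>2) * Im z)"
    by (simp add: power2_eq_square algebra_simps)
  finally show ?thesis by simp
qed

lemma Im_moebius_nonpos:
  assumes "\<bar>\<gamma>\<bar> < 1" "0 \<le> Im z"
  shows "Im (moebius (of_real \<gamma>) z) \<le> 0"
proof -
  have "0 \<le> 1 - \<gamma>\<^sup>2" using assms(1) by (simp add: abs_square_le_1)
  then show ?thesis using assms(2) by (simp add: Im_moebius_of_real)
qed

text \<open>Moebius involutions compose to a rotation followed by an involution. This carries the family of
  circles with one centre to a family with another centre.\<close>

lemma moebius_compose:
  assumes \<alpha>: "norm \<alpha> < 1" and b: "norm b < 1" and x: "norm x \<le> 1"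
  shows "moebius \<alpha> (moebius b x) = moebius (moebius \<alpha> b) (- ((1 - \<alpha> * cnj b) / (1 - cnj \<alpha> * b)) * x)"
proof -
  define D where "D = 1 - cnj b * x"
  define E where "E = 1 - cnj \<alpha> * b"
  have D: "D \<noteq> 0" unfolding D_def using b x by (rule moebius_denominator_nonzero)
  have E: "E \<noteq> 0" unfolding E_def using \<alpha> b by (intro moebius_denominator_nonzero) auto
  then have E': "cnj E \<noteq> 0" by simp
  have cE: "1 - \<alpha> * cnj b = cnj E" by (simp add: E_def)
  have "moebius \<alpha> (moebius b x) = ((\<alpha> * D - (b - x)) / D) / ((D - cnj \<alpha> * (b - x)) / D)"
    unfolding moebius_def D_def[symmetric] using D by (simp add: field_simps)
  also have "\<dots> = (\<alpha> * D - (b - x)) / (D - cnj \<alpha> * (b - x))"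
    using D by simp
  also have "\<alpha> * D - (b - x) = (\<alpha> - b) + cnj E * x"
    by (simp add: D_def E_def algebra_simps)
  also have "D - cnj \<alpha> * (b - x) = E + (cnj \<alpha> - cnj b) * x"
    by (simp add: D_def E_def algebra_simps)
  finally have L: "moebius \<alpha> (moebius b x) = ((\<alpha> - b) + cnj E * x) / (E + (cnj \<alpha> - cnj b) * x)" .
  have \<beta>: "moebius \<alpha> b = (\<alpha> - b) / E" by (simp add: moebius_def E_def)
  have "moebius (moebius \<alpha> b) (- (cnj E / E) * x)
      = ((\<alpha> - b) / E + cnj E / E * x) / (1 + (cnj \<alpha> - cnj b) / cnj E * (cnj E / E) * x)"
    unfolding \<beta> by (simp add: moebius_def[of "_ / _"])
  also have "(\<alpha> - b) / E + cnj E / E * x = ((\<alpha> - b) + cnj E * x) / E"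
    by (simp add: add_divide_distrib)
  also have "1 + (cnj \<alpha> - cnj b) / cnj E * (cnj E / E) * x = (E + (cnj \<alpha> - cnj b) * x) / E"
    using E E' by (simp add: add_divide_distrib)
  finally show ?thesis unfolding L cE E_def[symmetric] using E by simp
qed

text \<open>The ball goes to the bounded side of the circle for topological reasons: its image is
  open because \<open>moebius \<gamma>\<close> is an involution, so the frontier of the compact image of the closed
  ball lies on the circle, and interior points of a bounded set are inside its frontier.\<close>

lemma moebius_ball_inside:
  assumes \<gamma>: "norm \<gamma> < 1" and R: "R \<le> 1"
  shows "moebius \<gamma> ` ball 0 R \<subseteq> inside (moebius \<gamma> ` sphere 0 R)"
proof -
  let ?m = "moebius \<gamma>"
  have inv: "?m (?m z) = z" if "norm z \<le> 1" for z using moebius_involution[OF \<gamma> that] .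
  have le1: "norm z \<le> 1" if "norm z \<le> R" for z :: complex using that R by simp
  have ball_eq: "?m ` ball 0 R = ball 0 1 \<inter> ?m -` ball 0 R"
  proof (intro equalityI subsetI)
    fix w assume "w \<in> ?m ` ball 0 R"
    then obtain z where z: "w = ?m z" "norm z < R" by auto
    then show "w \<in> ball 0 1 \<inter> ?m -` ball 0 R"
      using R inv[of z] norm_moebius_less_1_iff[OF \<gamma>, of z] by auto
  next
    fix w assume "w \<in> ball 0 1 \<inter> ?m -` ball 0 R"
    then show "w \<in> ?m ` ball 0 R"
      using inv[of w] by (intro image_eqI[of _ _ "?m w"]) auto
  qed
  have "continuous_on (ball 0 1) ?m"
    by (rule continuous_on_subset[OF continuous_on_moebius[OF \<gamma>]]) auto
  then have op: "open (?m ` ball 0 R)"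
    unfolding ball_eq by (rule continuous_open_preimage) auto
  have comp: "compact (?m ` cball 0 R)"
    using R by (intro compact_continuous_image continuous_on_subset[OF continuous_on_moebius[OF \<gamma>]]) auto
  have int: "?m ` ball 0 R \<subseteq> interior (?m ` cball 0 R)"
    by (rule interior_maximal[OF _ op]) auto
  have "frontier (?m ` cball 0 R) \<subseteq> ?m ` cball 0 R - ?m ` ball 0 R"
    using int comp unfolding frontier_def by (auto simp: closure_closed compact_imp_closed)
  also have "\<dots> \<subseteq> ?m ` sphere 0 R" by fastforce
  finally have fr: "frontier (?m ` cball 0 R) \<subseteq> ?m ` sphere 0 R" .
  have disj: "?m ` ball 0 R \<inter> ?m ` sphere 0 R = {}"
  proof -
    have "?m z \<noteq> ?m w" if "norm z < R" "norm w = R" for z w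
    proof
      assume eq: "?m z = ?m w"
      have "z = ?m (?m z)" by (rule inv[OF le1, symmetric]) (use that in simp)
      also have "\<dots> = w" unfolding eq by (rule inv[OF le1]) (use that in simp)
      finally show False using that by simp
    qed
    then show ?thesis by auto
  qed
  show ?thesis
    using int interior_inside_frontier[OF compact_imp_bounded[OF comp]] inside_mono[OF fr] disj by blast
qed

section \<open>Extensions from concentric circles\<close>

text \<open>The circles are those in the closed unit disc centred at the origin. The parameter is the square \<open>s\<close> of the radius, because the mirror image \<open>s / cnj u\<close> of \<open>u\<close> in the circle
  \<open>norm u = sqrt s\<close> is then affine in the parameter.\<close>

definition circle_extensions :: "(complex \<Rightarrow> complex) \<Rightarrow> (real \<Rightarrow> complex \<Rightarrow> complex) \<Rightarrow> bool" where
  "circle_extensions f F \<longleftrightarrow> (\<forall>s. 0 < s \<longrightarrow> s \<le> 1 \<longrightarrow>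
     continuous_on (cball 0 (sqrt s)) (F s) \<and> F s holomorphic_on ball 0 (sqrt s) \<and>
     (\<forall>u. norm u = sqrt s \<longrightarrow> F s u = f u))"

text \<open>After rescaling all circles to the unit circle, the boundary values depend uniformly continuously
  on \<open>s\<close>, and by the maximum principle so do the extensions.\<close>

lemma circle_extensions_jointly_continuous:
  assumes F: "circle_extensions f F" and contf: "continuous_on (cball 0 1) f"
  shows "continuous_on {(s,u). 0 < s \<and> (norm u)\<^sup>2 \<le> s \<and> s \<le> 1} (\<lambda>(s,u). F s u)"
proof -
  \<comment> \<open>the extensions, rescaled to the closed unit disc\<close>
  define h where "h s x = F s (of_real (sqrt s) * x)" for s x
  have scale: "norm (of_real (sqrt s) * x) \<le> sqrt s \<longleftrightarrow> norm x \<le> 1"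
      "norm (of_real (sqrt s) * x) < sqrt s \<longleftrightarrow> norm x < 1" if "0 < s" for s and x :: complex
    using that by (auto simp: norm_mult)
  have contF: "continuous_on (cball 0 (sqrt s)) (F s)" and holF: "F s holomorphic_on ball 0 (sqrt s)"
    and bdryF: "\<And>u. norm u = sqrt s \<Longrightarrow> F s u = f u" if "0 < s" "s \<le> 1" for s
    using F that unfolding circle_extensions_def by auto
  have conth: "continuous_on (cball 0 1) (h s)" if "0 < s" "s \<le> 1" for s
    unfolding h_def
  proof (rule continuous_on_compose2[OF contF[OF that]])
    show "(*) (complex_of_real (sqrt s)) ` cball 0 1 \<subseteq> cball 0 (sqrt s)"
      using scale(1)[OF that(1)] by auto
  qed (auto intro!: continuous_intros)
  have holh: "h s holomorphic_on ball 0 1" if "0 < s" "s \<le> 1" for s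
  proof -
    have "(*) (complex_of_real (sqrt s)) ` ball 0 1 \<subseteq> ball 0 (sqrt s)"
      using scale(2)[OF that(1)] by auto
    then have "(F s \<circ> (*) (complex_of_real (sqrt s))) holomorphic_on ball 0 1"
      by (intro holomorphic_on_compose_gen[OF _ holF[OF that]]) (auto intro!: holomorphic_intros)
    then show ?thesis by (simp add: h_def[abs_def] o_def)
  qed
  have bdry: "h s x = f (of_real (sqrt s) * x)" if "0 < s" "s \<le> 1" "norm x = 1" for s x
    using that by (auto simp: h_def norm_mult bdryF)
  have unif: "\<exists>d>0. \<forall>s x. 0 < s \<longrightarrow> s \<le> 1 \<longrightarrow> \<bar>s - s0\<bar> < d \<longrightarrow> norm x \<le> 1 \<longrightarrow> norm (h s x - h s0 x) \<le> e"
    if "0 < s0" "s0 \<le> 1" "0 < e" for s0 e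
  proof -
    have "uniformly_continuous_on (cball 0 1) f"
      using contf by (simp add: compact_uniformly_continuous)
    then obtain d1 where "d1 > 0" and d1: "\<And>x y. x \<in> cball 0 1 \<Longrightarrow> y \<in> cball 0 1 \<Longrightarrow> dist y x < d1 \<Longrightarrow> dist (f y) (f x) < e"
      using \<open>0 < e\<close> unfolding uniformly_continuous_on_def by blast
    have "isCont sqrt s0" by (simp add: isCont_real_sqrt)
    then obtain d where "d > 0" and d: "\<And>s. \<bar>s - s0\<bar> < d \<Longrightarrow> \<bar>sqrt s - sqrt s0\<bar> < d1"
      using \<open>d1 > 0\<close> unfolding continuous_at_eps_delta by (auto simp: dist_real_def)
    have "norm (h s x - h s0 x) \<le> e" if s: "0 < s" "s \<le> 1" "\<bar>s - s0\<bar> < d" and x: "norm x \<le> 1" for s x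
    proof (rule maximum_modulus_frontier[of "\<lambda>x. h s x - h s0 x" "cball 0 1"])
      show "(\<lambda>x. h s x - h s0 x) holomorphic_on interior (cball 0 1)"
        using s \<open>0 < s0\<close> \<open>s0 \<le> 1\<close> by (auto intro!: holomorphic_intros holh)
      show "continuous_on (closure (cball 0 1)) (\<lambda>x. h s x - h s0 x)"
        using s \<open>0 < s0\<close> \<open>s0 \<le> 1\<close> by (auto intro!: continuous_intros conth)
      fix x :: complex assume "x \<in> frontier (cball 0 1)"
      then have nx: "norm x = 1" by simp
      have "dist (of_real (sqrt s) * x) (of_real (sqrt s0) * x) = \<bar>sqrt s - sqrt s0\<bar>"
        unfolding dist_norm left_diff_distrib[symmetric] of_real_diff[symmetric] norm_mult norm_of_real nx
        by (simp del: of_real_diff)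
      then have "dist (f (of_real (sqrt s) * x)) (f (of_real (sqrt s0) * x)) < e"
        using d[OF s(3)] s \<open>0 < s0\<close> \<open>s0 \<le> 1\<close> nx
        by (intro d1) (auto simp: norm_mult)
      then show "norm (h s x - h s0 x) \<le> e"
        using s \<open>0 < s0\<close> \<open>s0 \<le> 1\<close> nx by (simp add: bdry dist_norm)
    qed (use x in auto)
    with \<open>d > 0\<close> show ?thesis by blast
  qed
  have contH: "continuous_on ({0<..1} \<times> cball 0 1) (\<lambda>(s,x). h s x)"
    unfolding continuous_on_iff
  proof (intro ballI allI impI)
    fix p :: "real \<times> complex" and e :: real
    assume p: "p \<in> {0<..1} \<times> cball 0 1" and e: "0 < e"
    obtain s0 x0 where p_eq: "p = (s0, x0)" by fastforce
    with p have s0: "s0 \<in> {0<..1}" and x0: "x0 \<in> cball 0 1" by auto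
    obtain d1 where "d1 > 0" and d1: "\<And>s x. 0 < s \<Longrightarrow> s \<le> 1 \<Longrightarrow> \<bar>s - s0\<bar> < d1 \<Longrightarrow> norm x \<le> 1 \<Longrightarrow> norm (h s x - h s0 x) \<le> e/2"
      using unif[of s0 "e/2"] s0 e by auto
    have "continuous_on (cball 0 1) (h s0)" using conth s0 by simp
    then obtain d2 where "d2 > 0" and d2: "\<And>x. norm x \<le> 1 \<Longrightarrow> dist x x0 < d2 \<Longrightarrow> dist (h s0 x) (h s0 x0) < e/2"
      using x0 e unfolding continuous_on_iff by (metis half_gt_zero mem_cball_0)
    have "dist (h s x) (h s0 x0) < e" if "s \<in> {0<..1}" "x \<in> cball 0 1" "dist (s,x) (s0,x0) < min d1 d2" for s x
    proof -
      have "\<bar>s - s0\<bar> < d1" "dist x x0 < d2"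
        using that(3) dist_fst_le[of "(s,x)" "(s0,x0)"] dist_snd_le[of "(s,x)" "(s0,x0)"]
        by (auto simp: dist_real_def)
      then have "norm (h s x - h s0 x) \<le> e/2" "dist (h s0 x) (h s0 x0) < e/2"
        using d1 d2 that by auto
      then show ?thesis
        using dist_triangle[of "h s x" "h s0 x0" "h s0 x"] by (simp add: dist_norm)
    qed
    then show "\<exists>d>0. \<forall>x'\<in>{0<..1} \<times> cball 0 1. dist x' p < d \<longrightarrow>
        dist (case x' of (s, x) \<Rightarrow> h s x) (case p of (s, x) \<Rightarrow> h s x) < e"
      unfolding p_eq using \<open>d1 > 0\<close> \<open>d2 > 0\<close> by (intro exI[of _ "min d1 d2"]) auto
  qed
  have le: "norm u \<le> sqrt s" if "(norm u)\<^sup>2 \<le> s" for s and u :: complex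
    using that by (simp add: real_le_rsqrt)
  have "continuous_on {(s,u). 0 < s \<and> (norm u)\<^sup>2 \<le> s \<and> s \<le> 1}
     (\<lambda>p. (\<lambda>(s,x). h s x) (fst p, snd p / of_real (sqrt (fst p))))"
    by (rule continuous_on_compose2[OF contH]) (auto intro!: continuous_intros simp: norm_divide le)
  then show ?thesis
    by (rule continuous_on_eq) (auto simp: h_def)
qed

text \<open>Reflection in the real axis; it turns statements about the upper half disc into statements about
  the lower one.\<close>

lemma circle_extensions_cnj:
  assumes F: "circle_extensions f F"
  shows "circle_extensions (cnj \<circ> f \<circ> cnj) (\<lambda>s. cnj \<circ> F s \<circ> cnj)"
  unfolding circle_extensions_def
proof safe
  fix s :: real assume s: "0 < s" "s \<le> 1"
  have cF: "continuous_on (cball 0 (sqrt s)) (F s)" and hF: "F s holomorphic_on ball 0 (sqrt s)"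
    and bF: "\<And>u. norm u = sqrt s \<Longrightarrow> F s u = f u"
    using F s unfolding circle_extensions_def by auto
  show "continuous_on (cball 0 (sqrt s)) (cnj \<circ> F s \<circ> cnj)"
    unfolding o_def by (intro continuous_intros continuous_on_compose2[OF cF]) auto
  have "F s holomorphic_on cnj ` ball 0 (sqrt s)"
    by (rule holomorphic_on_subset[OF hF]) auto
  then show "(cnj \<circ> F s \<circ> cnj) holomorphic_on ball 0 (sqrt s)"
    by (intro holomorphic_on_compose_cnj_cnj) auto
  show "(cnj \<circ> F s \<circ> cnj) u = (cnj \<circ> f \<circ> cnj) u" if "norm u = sqrt s" for u
    using that by (simp add: bF)
qed

lemma circle_extensions_rotate:
  assumes F: "circle_extensions f F" and \<rho>: "norm \<rho> = 1"
    and g: "\<And>u. norm u \<le> 1 \<Longrightarrow> g u = f (\<rho> * u)"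
  shows "circle_extensions g (\<lambda>s u. F s (\<rho> * u))"
  unfolding circle_extensions_def
proof (intro allI impI conjI)
  fix s :: real assume s: "0 < s" "s \<le> 1"
  have cF: "continuous_on (cball 0 (sqrt s)) (F s)" and hF: "F s holomorphic_on ball 0 (sqrt s)"
    and bF: "\<And>u. norm u = sqrt s \<Longrightarrow> F s u = f u"
    using F s unfolding circle_extensions_def by auto
  show "continuous_on (cball 0 (sqrt s)) (\<lambda>u. F s (\<rho> * u))"
    by (intro continuous_on_compose2[OF cF]) (auto intro!: continuous_intros simp: norm_mult \<rho>)
  have "(F s \<circ> (*) \<rho>) holomorphic_on ball 0 (sqrt s)"
    by (intro holomorphic_on_compose_gen[OF _ hF]) (auto intro!: holomorphic_intros simp: norm_mult \<rho>)
  then show "(\<lambda>u. F s (\<rho> * u)) holomorphic_on ball 0 (sqrt s)"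
    by (simp add: o_def)
  show "F s (\<rho> * u) = g u" if "norm u = sqrt s" for u
    using that s by (simp add: bF norm_mult \<rho> g)
qed

lemma circle_extensions_of_circle_family:
  assumes \<gamma>: "norm \<gamma> < 1"
    and ext: "\<And>\<Gamma>. \<Gamma> \<in> circle_family \<gamma> \<Longrightarrow> extends_holomorphically_from \<Gamma> \<phi>"
  shows "\<exists>F. circle_extensions (\<phi> \<circ> moebius \<gamma>) F"
proof -
  let ?m = "moebius \<gamma>"
  have "\<exists>f. continuous_on (cball 0 (sqrt s)) f \<and> f holomorphic_on ball 0 (sqrt s) \<and>
     (\<forall>u. norm u = sqrt s \<longrightarrow> f u = (\<phi> \<circ> ?m) u)" if s: "0 < s" "s \<le> 1" for s
  proof -
    have R: "0 < sqrt s" "sqrt s \<le> 1" using s by auto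
    let ?\<Gamma> = "?m ` sphere 0 (sqrt s)"
    have "?\<Gamma> \<in> circle_family \<gamma>" unfolding circle_family_def using R by blast
    then obtain G where contG: "continuous_on (?\<Gamma> \<union> inside ?\<Gamma>) G" and holG: "G holomorphic_on inside ?\<Gamma>"
      and bd: "\<And>z. z \<in> ?\<Gamma> \<Longrightarrow> G z = \<phi> z"
      using ext unfolding extends_holomorphically_from_def by blast
    note ins = moebius_ball_inside[OF \<gamma> R(2)]
    have "?m ` cball 0 (sqrt s) \<subseteq> ?\<Gamma> \<union> inside ?\<Gamma>"
    proof (rule image_subsetI)
      fix x :: complex assume "x \<in> cball 0 (sqrt s)"
      then have "x \<in> sphere 0 (sqrt s) \<or> x \<in> ball 0 (sqrt s)" by auto
      then show "?m x \<in> ?\<Gamma> \<union> inside ?\<Gamma>" using ins by blast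
    qed
    moreover have "continuous_on (cball 0 (sqrt s)) ?m"
      by (rule continuous_on_subset[OF continuous_on_moebius[OF \<gamma>] subset_cball[OF R(2)]])
    ultimately have "continuous_on (cball 0 (sqrt s)) (G \<circ> ?m)"
      by (intro continuous_on_compose continuous_on_subset[OF contG])
    moreover have "?m holomorphic_on ball 0 (sqrt s)"
      by (rule holomorphic_on_subset[OF holomorphic_on_moebius[OF \<gamma>] subset_ball[OF R(2)]])
    then have "(G \<circ> ?m) holomorphic_on ball 0 (sqrt s)"
      using ins by (intro holomorphic_on_compose_gen[OF _ holG])
    moreover have "(G \<circ> ?m) u = (\<phi> \<circ> ?m) u" if "norm u = sqrt s" for u
      using that by (auto intro: bd)
    ultimately show ?thesis by blast
  qed
  then show ?thesis
    unfolding circle_extensions_def by metis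
qed

section \<open>Uniqueness from boundary values on an arc\<close>

text \<open>The map \<open>x \<mapsto> exp (\<i> * x)\<close> takes a half strip to the half disc and its bottom edge to the circular
  arc. Extended by zero below this edge, the pulled back function is holomorphic on the whole strip
  and vanishes on an open set.\<close>

lemma holomorphic_zero_on_upper_half_disc:
  assumes hol: "G holomorphic_on {z. norm z < 1 \<and> 0 < Im z}"
    and cont: "continuous_on {z. norm z \<le> 1 \<and> 0 < Im z} G"
    and zero: "\<And>z. norm z = 1 \<Longrightarrow> 0 < Im z \<Longrightarrow> G z = 0"
    and z: "norm z < 1" "0 < Im z"
  shows "G z = 0"
proof -
  \<comment> \<open>the strip that \<open>exp (\<i> * x)\<close> maps onto the upper half plane\<close>
  define S where "S = {x. 0 < Re x} \<inter> {x. Re x < pi}"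
  have "open S" "convex S"
    unfolding S_def by (auto intro!: open_Int convex_Int open_halfspace_Re_gt open_halfspace_Re_lt
        convex_halfspace_Re_gt convex_halfspace_Re_lt)
  define g where "g x = (if 0 \<le> Im x then G (exp (\<i> * x)) else 0)" for x
  have im: "0 < Im (exp (\<i> * x))" if "x \<in> S" for x
    using that by (auto simp: S_def Im_exp sin_gt_zero)
  have no: "norm (exp (\<i> * x)) = exp (- Im x)" for x by simp
  have contg: "continuous_on S g"
  proof -
    have "continuous_on S (\<lambda>x. if - Im x \<le> 0 then G (exp (\<i> * x)) else 0)"
    proof (rule continuous_on_cases_le)
      show "continuous_on {x \<in> S. - Im x \<le> 0} (\<lambda>x. G (exp (\<i> * x)))"
        using im by (intro continuous_on_compose2[OF cont]) (auto intro!: continuous_intros)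
      show "G (exp (\<i> * x)) = 0" if "x \<in> S" "- Im x = 0" for x
        using im[OF that(1)] no[of x] that(2) by (intro zero) auto
    qed (auto intro!: continuous_intros)
    then show ?thesis by (simp add: g_def[abs_def])
  qed
  have "g holomorphic_on S"
  proof (rule holomorphic_on_paste_across_line[OF \<open>open S\<close>, of \<i> _ 0])
    show "g holomorphic_on S \<inter> {z. \<i> \<bullet> z < 0}"
      by (rule holomorphic_transform[of "\<lambda>x. 0"]) (auto simp: g_def inner_complex_def)
    have "(G \<circ> (\<lambda>x. exp (\<i> * x))) holomorphic_on S \<inter> {z. 0 < \<i> \<bullet> z}"
      using im no by (intro holomorphic_on_compose_gen[OF _ hol])
        (auto intro!: holomorphic_intros simp: inner_complex_def)
    then show "g holomorphic_on S \<inter> {z. 0 < \<i> \<bullet> z}"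
      by (rule holomorphic_transform) (auto simp: g_def inner_complex_def)
  qed (auto simp: contg)
  define x where "x = - \<i> * Ln z"
  have nz: "z \<noteq> 0" using z by auto
  have ex: "exp (\<i> * x) = z" using nz by (simp add: x_def)
  have Rx: "Re x = Im (Ln z)" "Im x = - ln (norm z)" using nz by (auto simp: x_def)
  have xS: "x \<in> S"
    using z Im_Ln_pos_lt_imp[of z] nz unfolding S_def Rx
    by (auto simp: Rx Im_Ln_pos_lt)
  have "g x = 0"
  proof (rule analytic_continuation[OF \<open>g holomorphic_on S\<close> \<open>open S\<close>])
    let ?U = "S \<inter> {x. Im x < 0}"
    show "connected S" using \<open>convex S\<close> convex_connected by blast
    define p where "p = Complex (pi/2) (-1)"
    have "p \<in> ?U" by (auto simp: p_def S_def pi_gt_zero)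
    moreover have "open ?U" using \<open>open S\<close> by (auto intro!: open_Int open_halfspace_Im_lt)
    ultimately show "p islimpt ?U" "p \<in> S"
      using islimpt_subset[of p "?U" "?U"] open_imp_islimpt by blast+
    show "?U \<subseteq> S" by auto
    show "g y = 0" if "y \<in> ?U" for y using that by (auto simp: g_def)
  qed (rule xS)
  moreover have "0 \<le> Im x" using z nz by (simp add: Rx)
  ultimately show ?thesis by (simp add: g_def ex)
qed

section \<open>Moments along arcs of mirror images\<close>

definition arc_den :: "real \<Rightarrow> real \<Rightarrow> complex \<Rightarrow> complex" where
  "arc_den \<gamma> s u = (of_real \<gamma> - \<i>) * u - (1 - \<i> * of_real \<gamma>) * of_real s"

text \<open>Let \<open>u = moebius \<gamma> z\<close>. The point \<open>v = moebius \<gamma> (s / cnj u)\<close> is the mirror image of \<open>z\<close> in the circle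
  \<open>moebius \<gamma> ` sphere 0 (sqrt s)\<close>, and \<open>arc_point \<gamma> s u\<close> is the Cayley transform
  \<open>(w + \<i>) / (w - \<i>)\<close> of \<open>w = cnj v\<close>, with the fractions cleared so that the pole \<open>w = \<infinity>\<close> is harmless.
  While \<open>s\<close> grows from \<open>(norm u)\<^sup>2\<close> to \<open>1\<close>, the point \<open>w\<close> travels along a circular arc from \<open>cnj z\<close> to
  \<open>1 / z\<close>; this arc depends on \<open>\<gamma>\<close>, but its endpoints do not.\<close>

definition arc_point :: "real \<Rightarrow> real \<Rightarrow> complex \<Rightarrow> complex" where
  "arc_point \<gamma> s u = ((of_real \<gamma> + \<i>) * u - (1 + \<i> * of_real \<gamma>) * of_real s) / arc_den \<gamma> s u"

text \<open>The derivative of \<open>arc_point \<gamma> s u\<close> with respect to \<open>s\<close>, divided by \<open>2 * \<i>\<close>.\<close>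

definition arc_density :: "real \<Rightarrow> real \<Rightarrow> complex \<Rightarrow> complex" where
  "arc_density \<gamma> s u = (1 - (of_real \<gamma>)\<^sup>2) * u / (arc_den \<gamma> s u)\<^sup>2"

text \<open>The integral of the extension values \<open>F s u\<close> along the arc, against the \<open>n\<close>-th power of the Cayley
  coordinate.\<close>

definition moment :: "real \<Rightarrow> nat \<Rightarrow> (real \<Rightarrow> complex \<Rightarrow> complex) \<Rightarrow> complex \<Rightarrow> complex" where
  "moment \<gamma> n F z = integral {(norm (moebius (of_real \<gamma>) z))\<^sup>2..1}
     (\<lambda>s. F s (moebius (of_real \<gamma>) z) *
        (arc_point \<gamma> s (moebius (of_real \<gamma>) z) ^ n * arc_density \<gamma> s (moebius (of_real \<gamma>) z)))"

text \<open>The pole of the Cayley transform lies in the upper half plane, whereas the arcs that belong to points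
  \<open>z\<close> of the closed upper half disc stay in the closed lower half plane.\<close>

lemma arc_den_nonzero:
  assumes "\<bar>\<gamma>\<bar> < 1" "Im u \<le> 0" "0 < s"
  shows "arc_den \<gamma> s u \<noteq> 0"
proof
  assume "arc_den \<gamma> s u = 0"
  then have eq: "(of_real \<gamma> - \<i>) * u = (1 - \<i> * of_real \<gamma>) * of_real s"
    by (simp add: arc_den_def)
  have "Im ((of_real \<gamma> + \<i>) * ((of_real \<gamma> - \<i>) * u)) = Im ((of_real \<gamma> + \<i>) * ((1 - \<i> * of_real \<gamma>) * of_real s))"
    by (simp only: eq)
  then have "(\<gamma>\<^sup>2 + 1) * Im u = (1 - \<gamma>\<^sup>2) * s"
    by (simp add: algebra_simps power2_eq_square)
  moreover have "0 < (1 - \<gamma>\<^sup>2) * s" using assms by (simp add: abs_square_less_1)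
  moreover have "(\<gamma>\<^sup>2 + 1) * Im u \<le> 0" using assms by (simp add: mult_nonneg_nonpos)
  ultimately show False by simp
qed

lemma moment_integrand_continuous:
  assumes "\<bar>\<gamma>\<bar> < 1" and F: "circle_extensions f F" and contf: "continuous_on (cball 0 1) f"
    and D: "\<And>z. z \<in> D \<Longrightarrow> norm z \<le> 1 \<and> 0 \<le> Im z \<and> z \<noteq> of_real \<gamma>"
  shows "continuous_on {(s,z). z \<in> D \<and> (norm (moebius (of_real \<gamma>) z))\<^sup>2 \<le> s \<and> s \<le> 1}
     (\<lambda>(s,z). F s (moebius (of_real \<gamma>) z) *
        (arc_point \<gamma> s (moebius (of_real \<gamma>) z) ^ n * arc_density \<gamma> s (moebius (of_real \<gamma>) z)))"
proof -
  let ?m = "moebius (of_real \<gamma>)"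
  let ?S = "{(s,z). z \<in> D \<and> (norm (?m z))\<^sup>2 \<le> s \<and> s \<le> 1}"
  have "?m z \<noteq> 0" if "z \<in> D" for z
    using D[OF that] \<open>\<bar>\<gamma>\<bar> < 1\<close> by (subst moebius_eq_0_iff) auto
  then have pos: "0 < s" if "z \<in> D" "(norm (?m z))\<^sup>2 \<le> s" for s z
    using that by (meson order_less_le_trans zero_less_norm_iff zero_less_power)
  have contm: "continuous_on ?S (\<lambda>p. ?m (snd p))"
    using D \<open>\<bar>\<gamma>\<bar> < 1\<close> by (intro continuous_on_compose2[OF continuous_on_moebius])
      (auto intro!: continuous_intros)
  have 1: "continuous_on ?S (\<lambda>p. (\<lambda>(s,u). F s u) (fst p, ?m (snd p)))"
    by (rule continuous_on_compose2[OF circle_extensions_jointly_continuous[OF F contf]])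
       (auto intro!: continuous_intros contm pos)
  have "arc_den \<gamma> (fst p) (?m (snd p)) \<noteq> 0" if "p \<in> ?S" for p
  proof -
    have "snd p \<in> D" "0 < fst p" using that pos by auto
    then show ?thesis
      using D by (intro arc_den_nonzero Im_moebius_nonpos \<open>\<bar>\<gamma>\<bar> < 1\<close>) auto
  qed
  then have "continuous_on ?S (\<lambda>p. arc_point \<gamma> (fst p) (?m (snd p)) ^ n * arc_density \<gamma> (fst p) (?m (snd p)))"
    unfolding arc_point_def arc_density_def
    by (intro continuous_intros contm) (auto simp: arc_den_def intro!: continuous_intros contm)
  from continuous_on_mult[OF 1 this] show ?thesis
    by (simp add: case_prod_unfold)
qed

lemma continuous_on_moment:
  assumes "\<bar>\<gamma>\<bar> < 1" "circle_extensions f F" "continuous_on (cball 0 1) f"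
    and D: "\<And>z. z \<in> D \<Longrightarrow> norm z \<le> 1 \<and> 0 \<le> Im z \<and> z \<noteq> of_real \<gamma>"
  shows "continuous_on D (moment \<gamma> n F)"
  unfolding moment_def[abs_def]
proof (rule continuous_on_integral_moving_endpoint)
  have "continuous_on D (moebius (of_real \<gamma>))"
    using \<open>\<bar>\<gamma>\<bar> < 1\<close> D by (intro continuous_on_subset[OF continuous_on_moebius]) auto
  then show "continuous_on D (\<lambda>z. (norm (moebius (of_real \<gamma>) z))\<^sup>2)"
    by (intro continuous_intros)
  show "(norm (moebius (of_real \<gamma>) z))\<^sup>2 \<le> 1" if "z \<in> D" for z
    using D[OF that] \<open>\<bar>\<gamma>\<bar> < 1\<close> by (simp add: abs_square_le_1 norm_moebius_le_1)
qed (rule moment_integrand_continuous[OF assms])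

lemma moment_on_unit_circle:
  assumes "\<bar>\<gamma>\<bar> < 1" "norm z = 1"
  shows "moment \<gamma> n F z = 0"
proof -
  have "norm (moebius (of_real \<gamma>) z) = 1"
    using assms norm_moebius_le_1[of "of_real \<gamma>" z] norm_moebius_less_1_iff[of "of_real \<gamma>" z] by auto
  then show ?thesis by (simp add: moment_def)
qed

text \<open>The \<open>cnj z\<close>-derivative of a moment comes from the lower endpoint of the arc alone. There
  the mirror image is \<open>z\<close> itself and the extension value is \<open>\<phi> z\<close>, so the derivative is an
  expression in \<open>\<phi>\<close> and \<open>cnj z\<close> from which \<open>\<gamma>\<close> has disappeared.\<close>

lemma moment_triangle_integral:
  assumes \<gamma>: "\<bar>\<gamma>\<bar> < 1" and F: "circle_extensions (\<phi> \<circ> moebius (of_real \<gamma>)) F"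
    and cont: "continuous_on (cball 0 1) \<phi>" and z0: "norm z0 < 1" "0 < Im z0" and "0 < e"
  shows "\<exists>d>0. \<forall>a b c K. z0 \<in> convex hull {a,b,c} \<longrightarrow>
       dist a b \<le> K \<longrightarrow> dist b c \<le> K \<longrightarrow> dist c a \<le> K \<longrightarrow> K \<le> d \<longrightarrow>
       norm (triangle_integral (moment \<gamma> n F) a b c
             - \<phi> z0 * (((cnj z0 + \<i>) / (cnj z0 - \<i>)) ^ n / (cnj z0 - \<i>)\<^sup>2) * triangle_integral cnj a b c) \<le> e * K\<^sup>2"
proof -
  let ?m = "moebius (of_real \<gamma>)"
  let ?U = "{z. norm z < 1 \<and> 0 < Im z}"
  have n\<gamma>: "norm (complex_of_real \<gamma>) < 1" using \<gamma> by simp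
  have U: "norm z \<le> 1 \<and> 0 \<le> Im z \<and> z \<noteq> of_real \<gamma>" if "z \<in> ?U" for z
    using that by auto
  have contm: "continuous_on ?U ?m"
    by (rule continuous_on_subset[OF continuous_on_moebius[OF n\<gamma>]]) auto
  have contf: "continuous_on (cball 0 1) (\<phi> \<circ> ?m)"
    using norm_moebius_le_1[OF n\<gamma>]
    by (intro continuous_on_compose continuous_on_moebius n\<gamma> continuous_on_subset[OF cont]) auto
  have U_eq: "?U = ball 0 1 \<inter> {z. 0 < Im z}" by auto
  have "open ?U" unfolding U_eq by (intro open_Int open_ball open_halfspace_Im_gt)
  let ?q = "\<lambda>z. (norm (?m z))\<^sup>2"
  define m' where "m' = (of_real \<gamma> * cnj (of_real \<gamma>) - 1) / (1 - cnj (of_real \<gamma>) * z0)\<^sup>2"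
  define l where "l = ?m z0 * cnj m'"
  let ?P = "\<lambda>s z. F s (?m z) * (arc_point \<gamma> s (?m z) ^ n * arc_density \<gamma> s (?m z))"
  have main: "\<exists>d>0. \<forall>a b c K. z0 \<in> convex hull {a,b,c} \<longrightarrow>
       dist a b \<le> K \<longrightarrow> dist b c \<le> K \<longrightarrow> dist c a \<le> K \<longrightarrow> K \<le> d \<longrightarrow>
       norm (triangle_integral (\<lambda>z. integral {?q z..1} (\<lambda>s. ?P s z)) a b c
             + ?P (?q z0) z0 * l * triangle_integral cnj a b c) \<le> e * K\<^sup>2"
  proof (rule triangle_integral_moving_endpoint[OF \<open>open ?U\<close>])
    show "z0 \<in> ?U" using z0 by simp
    show "continuous_on ?U ?q" by (intro continuous_intros contm)
    show "?q z < 1" if "z \<in> ?U" for z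
      using that norm_moebius_less_1_iff[OF n\<gamma>, of z] by (simp add: abs_square_less_1)
    show "continuous_on {(s, z). z \<in> ?U \<and> ?q z \<le> s \<and> s \<le> 1} (\<lambda>(s, z). ?P s z)"
      by (rule moment_integrand_continuous[OF \<gamma> F contf U])
    show "?P s holomorphic_on {z \<in> ?U. ?q z < s}" if "s \<le> 1" for s
    proof (cases "0 < s")
      case False
      then have "{z \<in> ?U. ?q z < s} = {}" by (auto simp: not_less intro: order_trans)
      then show ?thesis by (metis holomorphic_on_empty)
    next
      case True
      have holm: "?m holomorphic_on {z \<in> ?U. ?q z < s}"
        by (rule holomorphic_on_subset[OF holomorphic_on_moebius[OF n\<gamma>]]) auto
      have lt: "norm u < sqrt s" if "(norm u)\<^sup>2 < s" for u :: complex
        using that by (simp add: real_less_rsqrt)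
      have "F s holomorphic_on ball 0 (sqrt s)"
        using F True that unfolding circle_extensions_def by blast
      then have "(F s \<circ> ?m) holomorphic_on {z \<in> ?U. ?q z < s}"
        by (intro holomorphic_on_compose_gen[OF holm]) (auto simp: lt)
      moreover have "arc_den \<gamma> s (?m z) \<noteq> 0" if "z \<in> ?U" for z
        using that True by (intro arc_den_nonzero \<gamma> Im_moebius_nonpos) auto
      moreover have "(\<lambda>z. arc_den \<gamma> s (?m z)) holomorphic_on {z \<in> ?U. ?q z < s}"
        unfolding arc_den_def by (intro holomorphic_intros holm)
      ultimately show ?thesis
        unfolding arc_point_def arc_density_def o_def
        by (intro holomorphic_intros holm) auto
    qed
    have "(?m has_field_derivative m') (at z0)"
      unfolding m'_def using z0 n\<gamma> by (intro moebius_has_field_derivative) auto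
    then have "(?m has_derivative (\<lambda>h. m' * h)) (at z0)"
      by (simp add: has_field_derivative_def)
    from has_derivative_inner[OF this this]
    show "(?q has_derivative (\<lambda>h. 2 * Re (l * cnj h))) (at z0)"
      unfolding power2_norm_eq_inner
      by (rule has_derivative_eq_rhs) (auto simp: l_def inner_complex_def algebra_simps)
  qed (rule \<open>0 < e\<close>)
  \<comment> \<open>at \<open>s = (norm u)\<^sup>2\<close> numerator and denominator of \<open>arc_point\<close> have a common factor that contains all of \<open>\<gamma>\<close>\<close>
  have "?P (?q z0) z0 * l = - (\<phi> z0 * (((cnj z0 + \<i>) / (cnj z0 - \<i>)) ^ n / (cnj z0 - \<i>)\<^sup>2))"
  proof -
    define c where "c = complex_of_real \<gamma>"
    define u where "u = ?m z0"
    define w where "w = cnj z0"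
    define d where "d = 1 - c * w"
    have u0: "u \<noteq> 0"
      unfolding u_def using z0 n\<gamma> by (subst moebius_eq_0_iff) auto
    have u1: "norm u \<le> 1"
      unfolding u_def using z0 n\<gamma> by (intro norm_moebius_le_1) auto
    have "cnj d \<noteq> 0"
      using moebius_denominator_nonzero[OF n\<gamma>, of z0] z0 by (simp add: d_def w_def c_def)
    then have d0: "d \<noteq> 0" by simp
    have cu: "cnj u = (c - w) / d"
      by (simp add: u_def moebius_def c_def w_def d_def)
    have s: "complex_of_real ((norm u)\<^sup>2) = u * cnj u"
      by (rule complex_norm_square)
    have w0: "w - \<i> \<noteq> 0"
      using z0 by (auto simp: w_def complex_eq_iff)
    have c0: "1 - c\<^sup>2 \<noteq> 0"
    proof -
      have "1 - c\<^sup>2 = of_real (1 - \<gamma>\<^sup>2)" by (simp add: c_def)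
      moreover have "\<gamma>\<^sup>2 \<noteq> 1" using \<gamma> by (simp add: abs_square_eq_1)
      ultimately show ?thesis by (metis eq_iff_diff_eq_0 of_real_eq_0_iff)
    qed
    have den: "arc_den \<gamma> ((norm u)\<^sup>2) u = u * ((1 - c\<^sup>2) * (w - \<i>) / d)"
    proof -
      have eq: "(c - \<i>) - (1 - \<i> * c) * ((c - w) / d) = (1 - c\<^sup>2) * (w - \<i>) / d"
        using d0 by (simp add: field_simps) (simp add: d_def algebra_simps power2_eq_square)
      show ?thesis
        unfolding arc_den_def s cu c_def[symmetric] eq[symmetric] by (simp add: algebra_simps)
    qed
    have num: "(c + \<i>) * u - (1 + \<i> * c) * of_real ((norm u)\<^sup>2) = u * ((1 - c\<^sup>2) * (w + \<i>) / d)"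
    proof -
      have eq: "(c + \<i>) - (1 + \<i> * c) * ((c - w) / d) = (1 - c\<^sup>2) * (w + \<i>) / d"
        using d0 by (simp add: field_simps) (simp add: d_def algebra_simps power2_eq_square)
      show ?thesis
        unfolding s cu eq[symmetric] by (simp add: algebra_simps)
    qed
    have pt: "arc_point \<gamma> ((norm u)\<^sup>2) u = (w + \<i>) / (w - \<i>)"
      unfolding arc_point_def den c_def[symmetric] num using u0 d0 c0 by simp
    have "arc_density \<gamma> ((norm u)\<^sup>2) u = (1 - c\<^sup>2) * u / (u * ((1 - c\<^sup>2) * (w - \<i>) / d))\<^sup>2"
      unfolding arc_density_def den c_def by simp
    also have "\<dots> = d\<^sup>2 / (u * (1 - c\<^sup>2) * (w - \<i>)\<^sup>2)"
      using u0 d0 c0 w0 by (simp add: divide_simps power2_eq_square)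
    finally have dens: "arc_density \<gamma> ((norm u)\<^sup>2) u = d\<^sup>2 / (u * (1 - c\<^sup>2) * (w - \<i>)\<^sup>2)" .
    have l: "l = - (u * (1 - c\<^sup>2) / d\<^sup>2)"
    proof -
      have "cnj m' = (c\<^sup>2 - 1) / d\<^sup>2"
        by (simp add: m'_def c_def d_def w_def power2_eq_square)
      then show ?thesis
        by (simp add: l_def u_def diff_divide_distrib right_diff_distrib)
    qed
    have "F ((norm u)\<^sup>2) u = (\<phi> \<circ> ?m) u"
      using F u0 u1 unfolding circle_extensions_def by (simp add: power_le_one)
    also have "\<dots> = \<phi> z0"
      unfolding u_def using moebius_involution[OF n\<gamma>, of z0] z0 by simp
    finally have Fu: "F ((norm u)\<^sup>2) u = \<phi> z0" .
    show ?thesis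
      unfolding u_def[symmetric] w_def[symmetric] Fu pt dens l using u0 d0 c0 w0 by simp
  qed
  with main show ?thesis by (simp add: moment_def[abs_def])
qed

text \<open>The two \<open>cnj z\<close>-derivatives cancel, so the difference of the moments is holomorphic on the upper half
  disc. It vanishes on the unit circle, where both arcs shrink to a point, hence everywhere on the
  half disc, and by continuity on the real axis.\<close>

lemma moment_difference_zero:
  assumes cont: "continuous_on (cball 0 1) \<phi>"
    and \<gamma>: "\<bar>\<gamma>\<bar> < 1" and F: "circle_extensions (\<phi> \<circ> moebius (of_real \<gamma>)) F"
    and \<delta>: "\<bar>\<delta>\<bar> < 1" and H: "circle_extensions (\<phi> \<circ> moebius (of_real \<delta>)) H"
    and x: "\<bar>x\<bar> < 1" "x \<noteq> \<gamma>" "x \<noteq> \<delta>"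
  shows "moment \<gamma> n F (of_real x) = moment \<delta> n H (of_real x)"
proof -
  let ?U = "{z. norm z < 1 \<and> 0 < Im z}"
  let ?D = "{z. norm z \<le> 1 \<and> 0 \<le> Im z \<and> z \<noteq> of_real \<gamma> \<and> z \<noteq> of_real \<delta>}"
  define G where "G z = moment \<gamma> n F z - moment \<delta> n H z" for z
  have contf: "continuous_on (cball 0 1) (\<phi> \<circ> moebius (of_real \<eta>))" if "\<bar>\<eta>\<bar> < 1" for \<eta>
    using that norm_moebius_le_1[of "of_real \<eta>"]
    by (intro continuous_on_compose continuous_on_moebius continuous_on_subset[OF cont]) auto
  have contD: "continuous_on ?D (moment \<gamma> n F)" "continuous_on ?D (moment \<delta> n H)"
    by (auto intro!: continuous_on_moment[OF \<gamma> F contf[OF \<gamma>]] continuous_on_moment[OF \<delta> H contf[OF \<delta>]])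
  have contG: "continuous_on ?D G"
    unfolding G_def by (intro continuous_intros contD)
  have UD: "?U \<subseteq> ?D" by auto
  have U_eq: "?U = ball 0 1 \<inter> {z. 0 < Im z}" by auto
  have "open ?U" unfolding U_eq by (intro open_Int open_ball open_halfspace_Im_gt)
  have holG: "G holomorphic_on ?U"
  proof (rule holomorphic_on_if_triangle_integrals_small[OF \<open>open ?U\<close>])
    show "continuous_on ?U G" by (rule continuous_on_subset[OF contG UD])
    fix z and e :: real assume z: "z \<in> ?U" and "0 < e"
    define k where "k = \<phi> z * (((cnj z + \<i>) / (cnj z - \<i>)) ^ n / (cnj z - \<i>)\<^sup>2)"
    have e2: "0 < e/2" using \<open>0 < e\<close> by simp
    obtain d1 where "d1 > 0" and d1: "\<And>a b c K. z \<in> convex hull {a,b,c} \<Longrightarrow>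
       dist a b \<le> K \<Longrightarrow> dist b c \<le> K \<Longrightarrow> dist c a \<le> K \<Longrightarrow> K \<le> d1 \<Longrightarrow>
       norm (triangle_integral (moment \<gamma> n F) a b c - k * triangle_integral cnj a b c) \<le> e/2 * K\<^sup>2"
      using moment_triangle_integral[OF \<gamma> F cont, of z "e/2" n] z e2 unfolding k_def by auto
    obtain d2 where "d2 > 0" and d2: "\<And>a b c K. z \<in> convex hull {a,b,c} \<Longrightarrow>
       dist a b \<le> K \<Longrightarrow> dist b c \<le> K \<Longrightarrow> dist c a \<le> K \<Longrightarrow> K \<le> d2 \<Longrightarrow>
       norm (triangle_integral (moment \<delta> n H) a b c - k * triangle_integral cnj a b c) \<le> e/2 * K\<^sup>2"
      using moment_triangle_integral[OF \<delta> H cont, of z "e/2" n] z e2 unfolding k_def by auto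
    obtain d3 where "d3 > 0" and d3: "cball z d3 \<subseteq> ?U"
      using \<open>open ?U\<close> z open_contains_cball by blast
    have "norm (triangle_integral G a b c) \<le> e * K\<^sup>2"
      if zT: "z \<in> convex hull {a,b,c}" and dist: "dist a b \<le> K" "dist b c \<le> K" "dist c a \<le> K"
        and K: "K \<le> min d1 (min d2 d3)" for a b c K
    proof -
      have "convex hull {a,b,c} \<subseteq> ?D"
      proof
        fix y assume "y \<in> convex hull {a,b,c}"
        then have "dist z y \<le> d3" using triangle_diameter[OF dist zT, of y] K by simp
        then show "y \<in> ?D" using d3 UD by auto
      qed
      then have "triangle_integral G a b c = triangle_integral (moment \<gamma> n F) a b c - triangle_integral (moment \<delta> n H) a b c"
        unfolding G_def by (intro triangle_integral_diff continuous_on_subset[OF contD(1)] continuous_on_subset[OF contD(2)])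
      also have "\<dots> = (triangle_integral (moment \<gamma> n F) a b c - k * triangle_integral cnj a b c)
           - (triangle_integral (moment \<delta> n H) a b c - k * triangle_integral cnj a b c)" by simp
      also have "norm \<dots> \<le> e/2 * K\<^sup>2 + e/2 * K\<^sup>2"
        using d1[OF zT dist] d2[OF zT dist] K by (meson add_mono min.boundedE norm_triangle_ineq4 order_trans)
      finally show ?thesis by (simp add: field_simps)
    qed
    then show "\<exists>d>0. \<forall>a b c K. z \<in> convex hull {a,b,c} \<longrightarrow>
       dist a b \<le> K \<longrightarrow> dist b c \<le> K \<longrightarrow> dist c a \<le> K \<longrightarrow> K \<le> d \<longrightarrow>
       norm (triangle_integral G a b c) \<le> e * K\<^sup>2"
      using \<open>d1 > 0\<close> \<open>d2 > 0\<close> \<open>d3 > 0\<close> by (intro exI[of _ "min d1 (min d2 d3)"]) auto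
  qed
  have zero: "G z = 0" if "norm z < 1" "0 < Im z" for z
  proof (rule holomorphic_zero_on_upper_half_disc[OF holG _ _ that])
    show "continuous_on {z. norm z \<le> 1 \<and> 0 < Im z} G"
      by (rule continuous_on_subset[OF contG]) auto
  qed (simp add: G_def moment_on_unit_circle \<gamma> \<delta>)
  have "G (of_real x) = 0"
  proof (rule ccontr)
    assume "G (of_real x) \<noteq> 0"
    then have pos: "0 < norm (G (of_real x))" by simp
    have "of_real x \<in> ?D" using x by auto
    with pos obtain d where "d > 0" and
      d: "\<And>z. z \<in> ?D \<Longrightarrow> dist z (of_real x) < d \<Longrightarrow> dist (G z) (G (of_real x)) < norm (G (of_real x))"
      using contG unfolding continuous_on_iff by meson
    \<comment> \<open>a point of the half disc closely above \<open>x\<close>\<close>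
    define y where "y = min (d/2) ((1 - \<bar>x\<bar>) / 2)"
    have y: "0 < y" "y < d" "y < 1 - \<bar>x\<bar>" using \<open>d > 0\<close> x by (auto simp: y_def min_def)
    define z where "z = of_real x + \<i> * of_real y"
    have "norm z \<le> \<bar>x\<bar> + \<bar>y\<bar>"
      unfolding z_def by (rule order_trans[OF norm_triangle_ineq]) (simp add: norm_mult)
    then have z: "norm z < 1" "0 < Im z" using y by (auto simp: z_def)
    moreover have "dist z (of_real x) < d" using y by (simp add: z_def dist_norm norm_mult)
    ultimately have "dist (G z) (G (of_real x)) < norm (G (of_real x))" using UD by (intro d) auto
    then show False using zero[OF z] by simp
  qed
  then show ?thesis by (simp add: G_def)
qed

section \<open>Functions on the circle determined by their moments\<close>

text \<open>Only the values on the unit circle matter, where \<open>cnj x\<close> is the inverse of \<open>x\<close>; writing it as \<open>cnj x\<close>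
  keeps these functions continuous on the whole plane and turns the restrictions of real polynomials
  in two variables into members of the class.\<close>

inductive trig_polynomial :: "(complex \<Rightarrow> complex) \<Rightarrow> bool" where
  monomial: "trig_polynomial (\<lambda>x. c * (x ^ j * cnj x ^ k))"
| add: "trig_polynomial f \<Longrightarrow> trig_polynomial g \<Longrightarrow> trig_polynomial (\<lambda>x. f x + g x)"

lemma trig_polynomial_mult:
  assumes "trig_polynomial f" "trig_polynomial g"
  shows "trig_polynomial (\<lambda>x. f x * g x)"
  using assms
proof (induction arbitrary: g)
  case (monomial c j k)
  then show ?case
  proof induction
    case (monomial d l m)
    have "(\<lambda>x. c * (x ^ j * cnj x ^ k) * (d * (x ^ l * cnj x ^ m))) = (\<lambda>x. (c * d) * (x ^ (j + l) * cnj x ^ (k + m)))"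
      by (simp add: power_add ac_simps)
    then show ?case by (simp only: trig_polynomial.monomial)
  next
    case (add f g)
    then show ?case by (simp only: distrib_left trig_polynomial.add)
  qed
next
  case (add f1 f2)
  then show ?case by (simp only: distrib_right trig_polynomial.add)
qed

lemma trig_polynomial_of_real_polynomial_function:
  assumes "real_polynomial_function q"
  shows "trig_polynomial (\<lambda>x. of_real (q x))"
  using assms
proof induction
  case (linear f)
  interpret bounded_linear f by fact
  define A where "A = (of_real (f 1) - \<i> * of_real (f \<i>)) / 2"
  define B where "B = (of_real (f 1) + \<i> * of_real (f \<i>)) / 2"
  have "of_real (f x) = A * (x ^ 1 * cnj x ^ 0) + B * (x ^ 0 * cnj x ^ 1)" for x
  proof -
    have "f x = f (Re x *\<^sub>R 1 + Im x *\<^sub>R \<i>)"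
      by (rule arg_cong[of _ _ f]) (simp add: complex_eq_iff)
    then have "f x = Re x * f 1 + Im x * f \<i>" by (simp only: add scaleR) simp
    then show ?thesis
      by (simp add: A_def B_def complex_eq_iff field_simps)
  qed
  then show ?case by (simp only: trig_polynomial.intros)
next
  case (const c)
  have "(\<lambda>x. complex_of_real c) = (\<lambda>x. of_real c * (x ^ 0 * cnj x ^ 0))" by simp
  then show ?case by (simp only: trig_polynomial.monomial)
next
  case (add f g)
  then show ?case by (simp only: of_real_add trig_polynomial.add)
next
  case (mult f g)
  then show ?case by (simp only: of_real_mult trig_polynomial_mult)
qed

lemma unit_monomial_cases:
  assumes "norm x = 1"
  shows "x ^ j * cnj x ^ k = (if k \<le> j then x ^ (j - k) else cnj x ^ (k - j))"
proof -
  have unit: "x ^ m * cnj x ^ m = 1" for m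
    using assms by (simp add: power_mult_distrib[symmetric] complex_norm_square[symmetric])
  show ?thesis
  proof (cases "k \<le> j")
    case True
    then have "x ^ j = x ^ (j - k) * x ^ k" by (simp add: power_add[symmetric])
    then show ?thesis using True unit[of k] by (simp add: mult.assoc)
  next
    case False
    then have "cnj x ^ k = cnj x ^ j * cnj x ^ (k - j)" by (simp add: power_add[symmetric])
    then show ?thesis using False unit[of j] by (simp add: mult.assoc[symmetric])
  qed
qed

text \<open>The curves lie on the unit circle, and \<open>p1\<close> does not meet the interior of \<open>p0\<close>. By the
  Weierstrass theorem the functional with vanishing moments kills every continuous function on the
  circle; testing it against a bump near an interior point of \<open>p0\<close> isolates the value of \<open>g0\<close> there.\<close>

lemma vanishing_moments_imp_zero:
  fixes g0 g1 p0 p1 :: "real \<Rightarrow> complex"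
  assumes "a < 1" "b < 1"
    and cont: "continuous_on {a..1} g0" "continuous_on {b..1} g1"
      "continuous_on {a..1} p0" "continuous_on {b..1} p1"
    and unit: "\<And>s. s \<in> {a..1} \<Longrightarrow> norm (p0 s) = 1" "\<And>s. s \<in> {b..1} \<Longrightarrow> norm (p1 s) = 1"
    and inj: "inj_on p0 {a..1}"
    and disj: "\<And>s t. a < s \<Longrightarrow> s < 1 \<Longrightarrow> t \<in> {b..1} \<Longrightarrow> p0 s \<noteq> p1 t"
    and moments: "\<And>n. integral {a..1} (\<lambda>s. g0 s * p0 s ^ n) + integral {b..1} (\<lambda>s. g1 s * p1 s ^ n) = 0"
      "\<And>n. integral {a..1} (\<lambda>s. g0 s * cnj (p0 s) ^ n) + integral {b..1} (\<lambda>s. g1 s * cnj (p1 s) ^ n) = 0"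
    and s0: "a < s0" "s0 < 1"
  shows "g0 s0 = 0"
proof -
  define N where "N q = integral {a..1} (\<lambda>s. g0 s * q (p0 s)) + integral {b..1} (\<lambda>s. g1 s * q (p1 s))" for q
  have mem: "p0 ` {a..1} \<subseteq> sphere 0 1" "p1 ` {b..1} \<subseteq> sphere 0 1"
    using unit by auto
  have contq: "continuous_on {a..1} (\<lambda>s. g0 s * q (p0 s))" "continuous_on {b..1} (\<lambda>s. g1 s * q (p1 s))"
    if "continuous_on (sphere 0 1) q" for q
    by (intro continuous_intros cont continuous_on_compose2[OF that] mem)+
  note intq = integrable_continuous_real[OF contq(1)] integrable_continuous_real[OF contq(2)]
  have trig_cont: "continuous_on (sphere 0 1) q" if "trig_polynomial q" for q
    using that by induction (intro continuous_intros; assumption)+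
  have N_trig: "N q = 0" if "trig_polynomial q" for q
    using that
  proof induction
    case (monomial c j k)
    have "N (\<lambda>x. c * (x ^ j * cnj x ^ k)) = N (\<lambda>x. c * (if k \<le> j then x ^ (j - k) else cnj x ^ (k - j)))"
      unfolding N_def
      by (intro arg_cong2[where f = "(+)"] integral_cong) (simp_all only: unit_monomial_cases unit)
    also have "\<dots> = c * (if k \<le> j then integral {a..1} (\<lambda>s. g0 s * p0 s ^ (j - k)) + integral {b..1} (\<lambda>s. g1 s * p1 s ^ (j - k))
        else integral {a..1} (\<lambda>s. g0 s * cnj (p0 s) ^ (k - j)) + integral {b..1} (\<lambda>s. g1 s * cnj (p1 s) ^ (k - j)))"
      unfolding N_def
      by (simp add: mult.left_commute[of _ c] distrib_left)
    also have "\<dots> = 0" by (simp add: moments)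
    finally show ?case .
  next
    case (add q r)
    have "N (\<lambda>x. q x + r x) = N q + N r"
      unfolding N_def distrib_left
      using add.hyps by (simp add: integral_add intq trig_cont)
    then show ?case using add.IH by simp
  qed
  obtain B0 where B0: "\<And>s. s \<in> {a..1} \<Longrightarrow> norm (g0 s) \<le> B0"
    using compact_imp_bounded[OF compact_continuous_image[OF cont(1) compact_Icc]]
    unfolding bounded_iff by blast
  obtain B1 where B1: "\<And>s. s \<in> {b..1} \<Longrightarrow> norm (g1 s) \<le> B1"
    using compact_imp_bounded[OF compact_continuous_image[OF cont(2) compact_Icc]]
    unfolding bounded_iff by blast
  \<comment> \<open>a bound for the norm of the functional \<open>N\<close>\<close>
  define C where "C = B0 * (1 - a) + B1 * (1 - b)"
  have N_cont: "N (\<lambda>x. of_real (q x)) = 0" if contq': "continuous_on (sphere 0 1) q" for q :: "complex \<Rightarrow> real"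
  proof -
    have *: "norm (N (\<lambda>x. of_real (q x))) \<le> e * C" if "0 < e" for e
    proof -
      obtain r where "real_polynomial_function r" and r: "\<And>x. x \<in> sphere 0 1 \<Longrightarrow> \<bar>q x - r x\<bar> < e"
        using Stone_Weierstrass_real_polynomial_function[OF compact_sphere contq' \<open>0 < e\<close>] by blast
      then have trig: "trig_polynomial (\<lambda>x. of_real (r x))"
        by (simp add: trig_polynomial_of_real_polynomial_function)
      have cq: "continuous_on (sphere 0 1) (\<lambda>x. complex_of_real (q x))"
        using contq' by (intro continuous_intros)
      have cd: "continuous_on (sphere 0 1) (\<lambda>x. complex_of_real (q x) - of_real (r x))"
        by (intro continuous_intros cq trig_cont[OF trig])
      have "N (\<lambda>x. of_real (q x)) = N (\<lambda>x. of_real (q x)) - N (\<lambda>x. of_real (r x))"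
        using N_trig[OF trig] by simp
      also have "\<dots> = N (\<lambda>x. of_real (q x) - of_real (r x))"
        unfolding N_def right_diff_distrib
        by (simp add: integral_diff intq[OF cq] intq[OF trig_cont[OF trig]])
      finally have eq: "N (\<lambda>x. of_real (q x)) = N (\<lambda>x. of_real (q x) - of_real (r x))" .
      have small: "norm (complex_of_real (q x) - of_real (r x)) \<le> e" if "norm x = 1" for x
        using r[of x] that by (simp only: of_real_diff[symmetric] norm_of_real) simp
      have "norm (integral {a..1} (\<lambda>s. g0 s * (of_real (q (p0 s)) - of_real (r (p0 s))))) \<le> B0 * e * (1 - a)"
      proof (rule integral_bound[OF _ contq(1)[OF cd]])
        fix s assume s: "s \<in> {a..1}"
        show "norm (g0 s * (of_real (q (p0 s)) - of_real (r (p0 s)))) \<le> B0 * e"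
          unfolding norm_mult
          by (intro mult_mono B0[OF s] small unit(1)[OF s] order_trans[OF norm_ge_zero B0[OF s]] norm_ge_zero)
      qed (use \<open>a < 1\<close> in simp)
      moreover have "norm (integral {b..1} (\<lambda>s. g1 s * (of_real (q (p1 s)) - of_real (r (p1 s))))) \<le> B1 * e * (1 - b)"
      proof (rule integral_bound[OF _ contq(2)[OF cd]])
        fix s assume s: "s \<in> {b..1}"
        show "norm (g1 s * (of_real (q (p1 s)) - of_real (r (p1 s)))) \<le> B1 * e"
          unfolding norm_mult
          by (intro mult_mono B1[OF s] small unit(2)[OF s] order_trans[OF norm_ge_zero B1[OF s]] norm_ge_zero)
      qed (use \<open>b < 1\<close> in simp)
      ultimately have "norm (N (\<lambda>x. of_real (q x))) \<le> B0 * e * (1 - a) + B1 * e * (1 - b)"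
        unfolding eq by (subst N_def) (meson add_mono norm_triangle_ineq order_trans)
      then show ?thesis by (simp add: C_def algebra_simps)
    qed
    show ?thesis
    proof (rule ccontr)
      assume "N (\<lambda>x. of_real (q x)) \<noteq> 0"
      then have pos: "0 < norm (N (\<lambda>x. of_real (q x)))" by simp
      define e where "e = norm (N (\<lambda>x. of_real (q x))) / (2 * (\<bar>C\<bar> + 1))"
      have "0 < e" using pos by (simp add: e_def)
      from *[OF this] have "norm (N (\<lambda>x. of_real (q x))) \<le> e * (\<bar>C\<bar> + 1)"
        using \<open>0 < e\<close> by (meson abs_ge_self le_add_same_cancel1 mult_left_mono order_trans zero_le_one less_imp_le)
      also have "\<dots> = norm (N (\<lambda>x. of_real (q x))) / 2"
        by (simp add: e_def field_simps add_nonneg_eq_0_iff)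
      finally show False using pos by simp
    qed
  qed
  show ?thesis
  proof (rule ccontr)
    assume nz: "g0 s0 \<noteq> 0"
    define \<nu> where "\<nu> = g0 s0"
    have contRe: "continuous_on {a..1} (\<lambda>s. Re (cnj \<nu> * g0 s))"
      by (intro continuous_intros cont)
    have Re0: "Re (cnj \<nu> * g0 s0) = (norm \<nu>)\<^sup>2"
      unfolding \<nu>_def cmod_power2 by (simp add: power2_eq_square)
    have pos: "0 < (norm \<nu>)\<^sup>2" using nz by (simp add: \<nu>_def)
    obtain \<eta> where "\<eta> > 0" and \<eta>: "\<And>s. s \<in> {a..1} \<Longrightarrow> dist s s0 < \<eta> \<Longrightarrow>
        dist (Re (cnj \<nu> * g0 s)) (Re (cnj \<nu> * g0 s0)) < (norm \<nu>)\<^sup>2"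
      using contRe s0 pos unfolding continuous_on_iff by (meson atLeastAtMost_iff less_imp_le)
    have Re_pos: "0 < Re (cnj \<nu> * g0 s)" if "s \<in> {a..1}" "\<bar>s - s0\<bar> < \<eta>" for s
      using \<eta>[OF that(1)] that(2) Re0 by (auto simp: dist_real_def)
    \<comment> \<open>the part of the two curves that the bump has to avoid\<close>
    define K where "K = p0 ` ({a..1} - {s0 - \<eta><..<s0 + \<eta>}) \<union> p1 ` {b..1}"
    have "compact K"
      unfolding K_def
      by (intro compact_Un compact_continuous_image continuous_on_subset[OF cont(3)] cont(4) compact_diff) auto
    moreover have "p0 s0 \<notin> K"
      using inj disj[OF s0] s0 \<open>\<eta> > 0\<close> unfolding K_def inj_on_def by force
    ultimately obtain \<delta> where "\<delta> > 0" and \<delta>: "ball (p0 s0) \<delta> \<inter> K = {}"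
      by (metis Compl_iff compact_imp_closed disjoint_eq_subset_Compl openE open_Compl)
    define bump where "bump x = max 0 (\<delta> - dist (p0 s0) x)" for x
    have cont_bump: "continuous_on A bump" for A
      unfolding bump_def by (intro continuous_intros)
    have bump0: "bump x = 0" if "x \<in> K" for x
    proof -
      have "x \<notin> ball (p0 s0) \<delta>" using that \<delta> by blast
      then show ?thesis by (simp add: bump_def)
    qed
    have "integral {b..1} (\<lambda>s. g1 s * of_real (bump (p1 s))) = integral {b..1} (\<lambda>s. 0)"
      by (intro integral_cong) (simp add: bump0 K_def)
    then have int0: "integral {a..1} (\<lambda>s. g0 s * of_real (bump (p0 s))) = 0"
      using N_cont[OF cont_bump] by (simp add: N_def)
    have cb: "continuous_on (sphere 0 1) (\<lambda>x. complex_of_real (bump x))"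
      by (intro continuous_intros cont_bump)
    define h where "h s = Re (cnj \<nu> * g0 s) * bump (p0 s)" for s
    have "bounded_linear (\<lambda>x. Re (cnj \<nu> * x))"
      by (intro bounded_linear_compose[OF bounded_linear_Re] bounded_linear_mult_right)
    from integral_linear[OF intq(1)[OF cb] this]
    have "integral {a..1} h = 0"
      by (simp add: o_def int0 h_def[abs_def] distrib_right mult.assoc[symmetric])
    moreover have "continuous_on {a..1} h"
      unfolding h_def
      by (intro continuous_on_mult contRe continuous_on_compose2[OF cont_bump[of UNIV] cont(3)]) auto
    moreover have "0 \<le> h s" if "s \<in> {a..1}" for s
    proof (cases "\<bar>s - s0\<bar> < \<eta>")
      case True
      then show ?thesis using Re_pos[OF that] by (simp add: h_def bump_def)
    next
      case False
      then have "s \<in> {a..1} - {s0 - \<eta><..<s0 + \<eta>}" using that by (auto simp: abs_less_iff)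
      then have "p0 s \<in> K" unfolding K_def by blast
      then show ?thesis by (simp add: h_def bump0)
    qed
    ultimately have "h s0 = 0"
      using integral_eq_0_iff[of a 1 h] \<open>a < 1\<close> s0 by auto
    moreover have "h s0 = (norm \<nu>)\<^sup>2 * \<delta>"
      unfolding h_def Re0 using \<open>\<delta> > 0\<close> by (simp add: bump_def)
    ultimately show False using pos \<open>\<delta> > 0\<close> by simp
  qed
qed

text \<open>When the two arcs together make up the circle, the hypotheses say that all Fourier coefficients of
  the function with values \<open>f0\<close> and \<open>f1\<close> vanish, except for its mean. The opposite signs of the weights
  express that one arc is run through backwards when they are joined to a closed curve, and they
  ensure that the total weight, which is the denominator of the mean, is nonzero.\<close>

lemma equal_moments_imp_constant:
  fixes f0 f1 p0 p1 :: "real \<Rightarrow> complex" and w0 w1 :: "real \<Rightarrow> real"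
  assumes ab: "a < 1" "b < 1"
    and cont: "continuous_on {a..1} f0" "continuous_on {b..1} f1"
      "continuous_on {a..1} w0" "continuous_on {b..1} w1"
      "continuous_on {a..1} p0" "continuous_on {b..1} p1"
    and unit: "\<And>s. s \<in> {a..1} \<Longrightarrow> norm (p0 s) = 1" "\<And>s. s \<in> {b..1} \<Longrightarrow> norm (p1 s) = 1"
    and inj: "inj_on p0 {a..1}"
    and disj: "\<And>s t. a < s \<Longrightarrow> s < 1 \<Longrightarrow> t \<in> {b..1} \<Longrightarrow> p0 s \<noteq> p1 t"
    and neg: "\<And>s. s \<in> {a..1} \<Longrightarrow> w0 s < 0" and pos: "\<And>s. s \<in> {b..1} \<Longrightarrow> 0 < w1 s"
    and moments: "\<And>n. integral {a..1} (\<lambda>s. f0 s * of_real (w0 s) * p0 s ^ Suc n) = integral {b..1} (\<lambda>s. f1 s * of_real (w1 s) * p1 s ^ Suc n)"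
    and cnj_moments: "\<And>n. integral {a..1} (\<lambda>s. f0 s * of_real (w0 s) * cnj (p0 s) ^ Suc n) = integral {b..1} (\<lambda>s. f1 s * of_real (w1 s) * cnj (p1 s) ^ Suc n)"
    and one_moments: "\<And>n. integral {a..1} (\<lambda>s. of_real (w0 s) * p0 s ^ Suc n) = integral {b..1} (\<lambda>s. of_real (w1 s) * p1 s ^ Suc n)"
    and s: "s \<in> {a..1}"
  shows "f0 s = f0 1"
proof -
  let ?I = "\<lambda>f. integral {a..1} f" and ?J = "\<lambda>f. integral {b..1} f"
  have one_cnj_moments: "?I (\<lambda>s. of_real (w0 s) * cnj (p0 s) ^ Suc n) = ?J (\<lambda>s. of_real (w1 s) * cnj (p1 s) ^ Suc n)" for n
    using arg_cong[OF one_moments[of n], of cnj] by (simp add: Henstock_Kurzweil_Integration.integral_cnj)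
  have "integral {a..1} w0 < 0"
  proof -
    have "0 \<le> integral {a..1} (\<lambda>s. - w0 s)"
      using neg by (intro integral_nonneg integrable_continuous_real continuous_intros cont) (auto simp: less_imp_le)
    moreover have "integral {a..1} (\<lambda>s. - w0 s) \<noteq> 0"
    proof
      assume "integral {a..1} (\<lambda>s. - w0 s) = 0"
      then have "\<forall>s\<in>{a..1}. - w0 s = 0"
        using neg ab by (subst (asm) integral_eq_0_iff) (auto intro!: continuous_intros cont simp: less_imp_le)
      then show False using neg[of 1] ab by auto
    qed
    ultimately show ?thesis by simp
  qed
  moreover have "0 \<le> integral {b..1} w1"
    using pos by (intro integral_nonneg integrable_continuous_real cont) (auto simp: less_imp_le)
  ultimately have W0: "integral {a..1} w0 - integral {b..1} w1 \<noteq> 0" by simp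
  define W where "W = ?I (\<lambda>s. of_real (w0 s)) - ?J (\<lambda>s. complex_of_real (w1 s))"
  have "W = of_real (integral {a..1} w0 - integral {b..1} w1)"
    using integral_linear[OF integrable_continuous_real[OF cont(3)] bounded_linear_of_real[where 'a = complex]]
      integral_linear[OF integrable_continuous_real[OF cont(4)] bounded_linear_of_real[where 'a = complex]]
    by (simp add: W_def o_def)
  then have "W \<noteq> 0" using W0 by (metis of_real_eq_0_iff)
  \<comment> \<open>the mean: with this \<open>c\<close> the zeroth moment of \<open>g0\<close>, \<open>g1\<close> vanishes as well\<close>
  define c where "c = (?I (\<lambda>s. f0 s * of_real (w0 s)) - ?J (\<lambda>s. f1 s * of_real (w1 s))) / W"
  have c: "c * W = ?I (\<lambda>s. f0 s * of_real (w0 s)) - ?J (\<lambda>s. f1 s * of_real (w1 s))"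
    using \<open>W \<noteq> 0\<close> by (simp add: c_def)
  define g0 where "g0 s = (f0 s - c) * of_real (w0 s)" for s
  define g1 where "g1 s = - ((f1 s - c) * of_real (w1 s))" for s
  have contg: "continuous_on {a..1} g0" "continuous_on {b..1} g1"
    unfolding g0_def g1_def by (intro continuous_intros cont)+
  have split: "?I (\<lambda>s. g0 s * q (p0 s)) + ?J (\<lambda>s. g1 s * q (p1 s))
     = (?I (\<lambda>s. f0 s * of_real (w0 s) * q (p0 s)) - ?J (\<lambda>s. f1 s * of_real (w1 s) * q (p1 s)))
       - c * (?I (\<lambda>s. of_real (w0 s) * q (p0 s)) - ?J (\<lambda>s. of_real (w1 s) * q (p1 s)))"
    if q: "continuous_on UNIV q" for q
  proof -
    have 1: "?I (\<lambda>s. g0 s * q (p0 s)) = ?I (\<lambda>s. f0 s * of_real (w0 s) * q (p0 s)) - c * ?I (\<lambda>s. of_real (w0 s) * q (p0 s))"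
      unfolding integral_mult_right[symmetric]
      by (subst integral_diff[symmetric])
        (auto intro!: integrable_continuous_real continuous_intros cont continuous_on_compose2[OF q] integral_cong
          simp: g0_def algebra_simps)
    have 2: "?J (\<lambda>s. g1 s * q (p1 s)) = c * ?J (\<lambda>s. of_real (w1 s) * q (p1 s)) - ?J (\<lambda>s. f1 s * of_real (w1 s) * q (p1 s))"
      unfolding integral_mult_right[symmetric]
      by (subst integral_diff[symmetric])
        (auto intro!: integrable_continuous_real continuous_intros cont continuous_on_compose2[OF q] integral_cong
          simp: g1_def algebra_simps)
    show ?thesis unfolding 1 2 by (simp add: algebra_simps)
  qed
  have m: "?I (\<lambda>s. g0 s * p0 s ^ n) + ?J (\<lambda>s. g1 s * p1 s ^ n) = 0" for n
  proof (cases n)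
    case 0
    show ?thesis
      using split[of "\<lambda>x. 1"] c by (simp add: 0 W_def continuous_on_const)
  next
    case (Suc k)
    show ?thesis
      using split[of "\<lambda>x. x ^ Suc k"] moments[of k] one_moments[of k]
      unfolding Suc by (simp add: continuous_intros del: power_Suc)
  qed
  have m': "?I (\<lambda>s. g0 s * cnj (p0 s) ^ n) + ?J (\<lambda>s. g1 s * cnj (p1 s) ^ n) = 0" for n
  proof (cases n)
    case 0
    show ?thesis
      using m[of 0] by (simp add: 0)
  next
    case (Suc k)
    have "continuous_on UNIV (\<lambda>x. cnj x ^ Suc k)" by (intro continuous_intros)
    from split[OF this] show ?thesis
      using cnj_moments[of k] one_cnj_moments[of k] unfolding Suc by (simp del: power_Suc)
  qed
  have f0c: "f0 s = c" if "s \<in> {a<..<1}" for s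
  proof -
    have "g0 s = 0"
      using that by (intro vanishing_moments_imp_zero[OF ab contg cont(5,6) unit inj disj m m']) auto
    then show ?thesis using neg[of s] that by (auto simp: g0_def)
  qed
  have cl: "closure {a<..<1} = {a..1}" using ab by simp
  have "f0 s = c" if "s \<in> {a..1}" for s
    by (rule continuous_constant_on_closure[of "{a<..<1}" f0 c]) (use that cont(1) f0c cl in auto)
  then show ?thesis using s ab by simp
qed

section \<open>Two real centres\<close>

text \<open>For real arguments numerator and denominator are conjugate, so the arc runs on the unit circle, and
  its angular velocity has the sign of \<open>r\<close>.\<close>

lemma arc_point_on_reals:
  assumes "\<bar>\<gamma>\<bar> < 1" "0 < s"
  shows "norm (arc_point \<gamma> s (of_real r)) = 1"
    and "arc_density \<gamma> s (of_real r) =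
      of_real ((1 - \<gamma>\<^sup>2) * r / (norm (arc_den \<gamma> s (of_real r)))\<^sup>2) * arc_point \<gamma> s (of_real r)"
proof -
  have nz: "arc_den \<gamma> s (of_real r) \<noteq> 0" using assms by (intro arc_den_nonzero) auto
  have pt: "arc_point \<gamma> s (of_real r) = cnj (arc_den \<gamma> s (of_real r)) / arc_den \<gamma> s (of_real r)"
    by (simp add: arc_point_def arc_den_def)
  show "norm (arc_point \<gamma> s (of_real r)) = 1"
    unfolding pt using nz by (simp add: norm_divide)
  show "arc_density \<gamma> s (of_real r) =
      of_real ((1 - \<gamma>\<^sup>2) * r / (norm (arc_den \<gamma> s (of_real r)))\<^sup>2) * arc_point \<gamma> s (of_real r)"
    unfolding pt arc_density_def of_real_divide complex_norm_square
    using nz by (simp add: field_simps power2_eq_square)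
qed

lemma arc_point_eq_on_reals:
  assumes "\<bar>\<gamma>\<bar> < 1" "0 < s" "\<bar>\<delta>\<bar> < 1" "0 < s'"
    and eq: "arc_point \<gamma> s (of_real u) = arc_point \<delta> s' (of_real v)"
  shows "(\<gamma> * u - s) * (\<delta> * s' - v) = (\<gamma> * s - u) * (\<delta> * v - s')"
proof -
  have nz: "arc_den \<gamma> s (of_real u) \<noteq> 0" "arc_den \<delta> s' (of_real v) \<noteq> 0"
    using assms(1-4) arc_den_nonzero[of \<gamma> "of_real u" s] arc_den_nonzero[of \<delta> "of_real v" s'] by simp_all
  have "cnj (arc_den \<gamma> s (of_real u)) / arc_den \<gamma> s (of_real u) = cnj (arc_den \<delta> s' (of_real v)) / arc_den \<delta> s' (of_real v)"
    using eq by (simp add: arc_point_def arc_den_def)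
  then have "cnj (arc_den \<gamma> s (of_real u)) * arc_den \<delta> s' (of_real v) = cnj (arc_den \<delta> s' (of_real v)) * arc_den \<gamma> s (of_real u)"
    using nz by (simp add: field_simps)
  then have "Im (cnj (arc_den \<gamma> s (of_real u)) * arc_den \<delta> s' (of_real v)) = Im (cnj (arc_den \<delta> s' (of_real v)) * arc_den \<gamma> s (of_real u))"
    by (rule arg_cong)
  then show ?thesis
    by (simp add: arc_den_def algebra_simps)
qed

text \<open>Here \<open>z = x\<close> is a point between the two centres. Mirror images of a real point are real: as the
  radius grows, the mirror image in the circles around \<open>0\<close> moves from \<open>x\<close> up to \<open>1 / x\<close>, and in
  those around \<open>t\<close> it moves from \<open>x\<close> down through \<open>0\<close> and \<open>\<infinity>\<close> to \<open>1 / x\<close>. So the two arcs together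
  cover the extended real line once. Their moments agree, also after complex conjugation, and
  therefore the extension values are constant along the arcs. The sign in \<open>- of_real x\<close> comes from
  \<open>moebius 0 u = - u\<close>.\<close>

lemma extension_constant_between_centres:
  assumes cont: "continuous_on (cball 0 1) \<phi>" and x: "0 < x" "x < t" "t < 1"
    and F: "circle_extensions (\<phi> \<circ> moebius 0) F"
    and H: "circle_extensions (\<phi> \<circ> moebius (of_real t)) H"
    and s: "x\<^sup>2 \<le> s" "s \<le> 1"
  shows "F s (- of_real x) = F 1 (- of_real x)"
proof -
  have t: "\<bar>t\<bar> < 1" and z1: "\<bar>0::real\<bar> < 1" using x by auto
  have tx: "t * x < 1" using x mult_strict_mono[of t 1 x 1] by auto
  \<comment> \<open>the point \<open>x\<close> seen from \<open>t\<close>\<close>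
  define y where "y = (t - x) / (1 - t * x)"
  have y_eq: "y * (1 - t * x) = t - x" using tx by (simp add: y_def)
  have y0: "0 < y" using x tx by (simp add: y_def)
  have "0 < (1 - t) * (1 + x)" using x by simp
  then have y1: "y < 1" using tx by (simp add: y_def algebra_simps)
  have m0: "moebius (of_real 0) (of_real x) = of_real (- x)" by (simp add: moebius_def)
  have mt: "moebius (of_real t) (of_real x) = of_real y" by (simp add: moebius_def y_def)
  have F': "circle_extensions (\<phi> \<circ> moebius (of_real 0)) F" using F by simp
  \<comment> \<open>the angular velocities, up to a common factor: negative on the first arc, positive on the second\<close>
  define w0 where "w0 s = (1 - 0\<^sup>2) * (- x) / (norm (arc_den 0 s (of_real (- x))))\<^sup>2" for s
  define w1 where "w1 s = (1 - t\<^sup>2) * y / (norm (arc_den t s (of_real y)))\<^sup>2" for s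
  define p0 where "p0 s = arc_point 0 s (of_real (- x))" for s
  define p1 where "p1 s = arc_point t s (of_real y)" for s
  have s0: "0 < s" if "s \<in> {x\<^sup>2..1}" for s using that x by (auto intro: less_le_trans[of 0 "x\<^sup>2"])
  have s1: "0 < s" if "s \<in> {y\<^sup>2..1}" for s using that y0 by (auto intro: less_le_trans[of 0 "y\<^sup>2"])
  have d0: "arc_den 0 s (of_real (- x)) \<noteq> 0" if "s \<in> {x\<^sup>2..1}" for s
    using s0[OF that] by (intro arc_den_nonzero z1) auto
  have d1: "arc_den t s (of_real y) \<noteq> 0" if "s \<in> {y\<^sup>2..1}" for s
    using s1[OF that] by (intro arc_den_nonzero t) auto
  have t2: "0 < 1 - t\<^sup>2" using t by (simp add: abs_square_less_1)
  have moment0: "moment 0 n G (of_real x) = integral {x\<^sup>2..1} (\<lambda>s. G s (of_real (- x)) * of_real (w0 s) * p0 s ^ Suc n)" for G n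
    unfolding moment_def m0 norm_of_real abs_minus_cancel power2_abs
    by (intro integral_cong)
       (use s0 in \<open>simp add: arc_point_on_reals(2)[OF z1] w0_def p0_def mult_ac del: of_real_minus of_real_divide of_real_mult\<close>)
  have moment1: "moment t n G (of_real x) = integral {y\<^sup>2..1} (\<lambda>s. G s (of_real y) * of_real (w1 s) * p1 s ^ Suc n)" for G n
    unfolding moment_def mt norm_of_real power2_abs
    by (intro integral_cong)
       (use s1 in \<open>simp add: arc_point_on_reals(2)[OF t] w1_def p1_def mult_ac del: of_real_divide of_real_mult\<close>)
  have eq: "moment 0 n F0 (of_real x) = moment t n F1 (of_real x)"
    if "continuous_on (cball 0 1) f" "circle_extensions (f \<circ> moebius (of_real 0)) F0"
      "circle_extensions (f \<circ> moebius (of_real t)) F1" for f F0 F1 n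
    using x by (intro moment_difference_zero[OF that(1) z1 that(2) t that(3)]) auto
  have moments: "integral {x\<^sup>2..1} (\<lambda>s. F s (of_real (- x)) * of_real (w0 s) * p0 s ^ Suc n) =
      integral {y\<^sup>2..1} (\<lambda>s. H s (of_real y) * of_real (w1 s) * p1 s ^ Suc n)" for n
    using eq[OF cont F' H, of n] unfolding moment0 moment1 .
  \<comment> \<open>the constant function \<open>1\<close> satisfies all hypotheses\<close>
  have one_moments: "integral {x\<^sup>2..1} (\<lambda>s. of_real (w0 s) * p0 s ^ Suc n) =
      integral {y\<^sup>2..1} (\<lambda>s. of_real (w1 s) * p1 s ^ Suc n)" for n
  proof -
    have "circle_extensions ((\<lambda>_. 1) \<circ> g) (\<lambda>_ _. 1)" for g :: "complex \<Rightarrow> complex"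
      by (auto simp: circle_extensions_def)
    from eq[OF continuous_on_const this this, of n] show ?thesis
      unfolding moment0 moment1 by simp
  qed
  have cnj_moments: "integral {x\<^sup>2..1} (\<lambda>s. F s (of_real (- x)) * of_real (w0 s) * cnj (p0 s) ^ Suc n) =
      integral {y\<^sup>2..1} (\<lambda>s. H s (of_real y) * of_real (w1 s) * cnj (p1 s) ^ Suc n)" for n
  proof -
    have comm: "cnj \<circ> (\<phi> \<circ> moebius (of_real r)) \<circ> cnj = (cnj \<circ> \<phi> \<circ> cnj) \<circ> moebius (of_real r)" for r
      by (auto simp: fun_eq_iff moebius_def)
    have cc: "continuous_on (cball 0 1) (cnj \<circ> \<phi> \<circ> cnj)"
      unfolding o_def by (intro continuous_intros continuous_on_compose2[OF cont]) auto
    from eq[OF cc circle_extensions_cnj[OF F', unfolded comm] circle_extensions_cnj[OF H, unfolded comm], of n]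
    have "integral {x\<^sup>2..1} (\<lambda>s. cnj (F s (of_real (- x))) * of_real (w0 s) * p0 s ^ Suc n) =
      integral {y\<^sup>2..1} (\<lambda>s. cnj (H s (of_real y)) * of_real (w1 s) * p1 s ^ Suc n)"
      unfolding moment0 moment1 by simp
    from arg_cong[OF this, of cnj] show ?thesis
      by (simp add: Henstock_Kurzweil_Integration.integral_cnj)
  qed
  have contw: "continuous_on {x\<^sup>2..1} w0" "continuous_on {y\<^sup>2..1} w1"
    unfolding w0_def w1_def using d0 d1 x
    by (auto intro!: continuous_intros simp: arc_den_def)
  have contp: "continuous_on {x\<^sup>2..1} p0" "continuous_on {y\<^sup>2..1} p1"
    unfolding p0_def p1_def arc_point_def using d0 d1 x
    by (auto intro!: continuous_intros simp: arc_den_def)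
  have contfib: "continuous_on {r\<^sup>2..1} (\<lambda>s. G s (of_real q))"
    if "circle_extensions (\<phi> \<circ> moebius (of_real c)) G" "\<bar>c\<bar> < 1" "\<bar>q\<bar> = r" "0 < r" for c r q G
  proof -
    have cf: "continuous_on (cball 0 1) (\<phi> \<circ> moebius (of_real c))"
      using that(2) norm_moebius_le_1[of "of_real c"]
      by (intro continuous_on_compose continuous_on_moebius continuous_on_subset[OF cont]) auto
    have "continuous_on {r\<^sup>2..1} (\<lambda>s. (\<lambda>(s,u). G s u) (s, complex_of_real q))"
      by (rule continuous_on_compose2[OF circle_extensions_jointly_continuous[OF that(1) cf]])
         (use that(3,4) in \<open>auto intro!: continuous_intros intro: less_le_trans[of 0 "r\<^sup>2"]\<close>)
    then show ?thesis by simp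
  qed
  have x2: "x\<^sup>2 < 1" "y\<^sup>2 < 1"
    using x y0 y1 by (auto simp: power_less_one_iff)
  have "F s (of_real (- x)) = F 1 (of_real (- x))"
  proof (rule equal_moments_imp_constant[OF x2 _ _ contw contp _ _ _ _ _ _ moments cnj_moments one_moments])
    show "continuous_on {x\<^sup>2..1} (\<lambda>s. F s (of_real (- x)))"
      by (rule contfib[OF F']) (use x in auto)
    show "continuous_on {y\<^sup>2..1} (\<lambda>s. H s (of_real y))"
      by (rule contfib[OF H t]) (use y0 in auto)
    show "norm (p0 s) = 1" if "s \<in> {x\<^sup>2..1}" for s
      unfolding p0_def using s0[OF that] by (intro arc_point_on_reals z1)
    show "norm (p1 s) = 1" if "s \<in> {y\<^sup>2..1}" for s
      unfolding p1_def using s1[OF that] by (intro arc_point_on_reals t)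
    show "w0 s < 0" if "s \<in> {x\<^sup>2..1}" for s
      using d0[OF that] x by (simp add: w0_def)
    show "0 < w1 s" if "s \<in> {y\<^sup>2..1}" for s
      using d1[OF that] y0 t2 by (simp add: w1_def)
    show "inj_on p0 {x\<^sup>2..1}"
    proof (rule inj_onI)
      fix s s' assume "s \<in> {x\<^sup>2..1}" "s' \<in> {x\<^sup>2..1}" "p0 s = p0 s'"
      then show "s = s'"
        using arc_point_eq_on_reals[OF z1 s0 z1 s0, of s s' "- x" "- x"] x by (simp add: p0_def)
    qed
    \<comment> \<open>A common point would be the mirror image \<open>s / x\<close>, seen from \<open>t\<close> at the parameter \<open>s\'\<close>; solving for \<open>s\'\<close> gives a value below \<open>y\<^sup>2\<close> or above \<open>1\<close>, according to the side of the pole \<open>1 / t\<close> on which \<open>s / x\<close> lies.\<close>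
    show "p0 s \<noteq> p1 s'" if s: "x\<^sup>2 < s" "s < 1" and s': "s' \<in> {y\<^sup>2..1}" for s s'
    proof
      assume "p0 s = p1 s'"
      then have "(0 * (- x) - s) * (t * s' - y) = (0 * s - (- x)) * (t * y - s')"
        using s0[of s] s1[OF s'] s unfolding p0_def p1_def by (intro arc_point_eq_on_reals z1 t) auto
      then have e: "s' * (x - s * t) = y * (x * t - s)" by (simp add: algebra_simps)
      consider "x - s * t > 0" | "x - s * t < 0" | "x = s * t" by linarith
      then show False
      proof cases
        case 1
        then have "y * y * (x - s * t) \<le> s' * (x - s * t)"
          using s' by (intro mult_right_mono) (auto simp: power2_eq_square)
        then have "y * (y * (x - s * t)) \<le> y * (x * t - s)"
          using e by (simp add: mult.assoc)
        then have "y * (x - s * t) \<le> x * t - s" using y0 by simp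
        then have "y * (x - s * t) * (1 - t * x) \<le> (x * t - s) * (1 - t * x)"
          using tx by (intro mult_right_mono) auto
        moreover have "y * (x - s * t) * (1 - t * x) = (t - x) * (x - s * t)"
          using y_eq by (metis mult.assoc mult.commute)
        ultimately have "0 \<le> (1 - t\<^sup>2) * (x\<^sup>2 - s)"
          by (simp add: algebra_simps power2_eq_square)
        then show False using t2 s(1) by (simp add: zero_le_mult_iff)
      next
        case 2
        then have "s' * (s * t - x) \<le> 1 * (s * t - x)"
          using s' by (intro mult_right_mono) auto
        moreover have "s' * (s * t - x) = y * (s - x * t)" using e by (simp add: algebra_simps)
        ultimately have "y * (s - x * t) \<le> s * t - x" by simp
        then have "y * (s - x * t) * (1 - t * x) \<le> (s * t - x) * (1 - t * x)"
          using tx by (intro mult_right_mono) auto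
        moreover have "y * (s - x * t) * (1 - t * x) = (t - x) * (s - x * t)"
          using y_eq by (metis mult.assoc mult.commute)
        ultimately have "0 \<le> (x * (1 - t\<^sup>2)) * (s - 1)"
          by (simp add: algebra_simps power2_eq_square)
        moreover have "(x * (1 - t\<^sup>2)) * (s - 1) < 0"
          using t2 s(2) x by (intro mult_pos_neg mult_pos_pos) auto
        ultimately show False by simp
      next
        case 3
        then have "x * t = s" using e y0 by simp
        then have "s * (1 - t\<^sup>2) = 0" using 3 by (simp add: algebra_simps power2_eq_square)
        then show False using t2 s(1) x by auto
      qed
    qed
    show "s \<in> {x\<^sup>2..1}" using s by simp
  qed
  then show ?thesis by simp
qed

text \<open>By the identity theorem, agreement of the extensions on a real interval makes the extension from
  each circle around \<open>0\<close> the restriction of the extension from the unit circle, which therefore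
  agrees with \<open>\<phi>\<close> on all circles.\<close>

lemma holomorphic_if_two_real_centres:
  assumes cont: "continuous_on (cball 0 1) \<phi>" and t: "0 < t" "t < 1"
    and F: "circle_extensions (\<phi> \<circ> moebius 0) F"
    and H: "circle_extensions (\<phi> \<circ> moebius (of_real t)) H"
  shows "\<phi> holomorphic_on ball 0 1"
proof -
  have contF: "continuous_on (cball 0 (sqrt s)) (F s)" and holF: "F s holomorphic_on ball 0 (sqrt s)"
    and bdryF: "\<And>u. norm u = sqrt s \<Longrightarrow> F s u = \<phi> (- u)" if "0 < s" "s \<le> 1" for s
    using F that unfolding circle_extensions_def by (auto simp: moebius_def)
  have contF1: "continuous_on (cball 0 1) (F 1)" and holF1: "F 1 holomorphic_on ball 0 1"
    using contF[of 1] holF[of 1] by auto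
  have "F s u = F 1 u" if s: "0 < s" "s \<le> 1" and u: "norm u < sqrt s" for s u
  proof -
    have s1: "sqrt s \<le> 1" using s by simp
    let ?D = "\<lambda>u. F s u - F 1 u"
    let ?V = "(\<lambda>x. - complex_of_real x) ` {0<..<min t (sqrt s)}"
    have "?D u = 0"
    proof (rule analytic_continuation[of ?D "ball 0 (sqrt s)" ?V 0 u])
      show "?D holomorphic_on ball 0 (sqrt s)"
        by (intro holomorphic_intros holF[OF s] holomorphic_on_subset[OF holF1 subset_ball[OF s1]])
      show "open (ball (0::complex) (sqrt s))" "connected (ball (0::complex) (sqrt s))" by auto
      show "?V \<subseteq> ball 0 (sqrt s)" by auto
      show "0 \<in> ball (0::complex) (sqrt s)" using s by simp
      show "u \<in> ball 0 (sqrt s)" using u by simp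
      show "0 islimpt ?V"
        unfolding islimpt_approachable
      proof (intro allI impI)
        fix e :: real assume "0 < e"
        define x where "x = min (e / 2) (min t (sqrt s) / 2)"
        have "0 < x" "x < e" "x < min t (sqrt s)"
          using \<open>0 < e\<close> t s by (auto simp: x_def min_def)
        then show "\<exists>x'\<in>?V. x' \<noteq> 0 \<and> dist x' 0 < e"
          by (intro bexI[of _ "- complex_of_real x"]) auto
      qed
      show "?D v = 0" if v: "v \<in> ?V" for v
      proof -
        obtain x where x: "v = - of_real x" "0 < x" "x < t" "x < sqrt s" using v by auto
        have xs: "x\<^sup>2 \<le> s"
          using x(2,4) s by (intro sqrt_ge_absD) auto
        show ?thesis
          unfolding x(1) extension_constant_between_centres[OF cont x(2,3) t(2) F H xs s(2)] by simp
      qed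
    qed
    then show ?thesis by simp
  qed
  note inner = this
  have outer: "\<phi> (- u) = F 1 u" if u: "u \<noteq> 0" "norm u \<le> 1" for u
  proof -
    define s where "s = (norm u)\<^sup>2"
    have s: "0 < s" "s \<le> 1" "sqrt s = norm u" using u by (auto simp: s_def power_le_one)
    have cl: "closure (ball 0 (sqrt s)) = cball (0::complex) (sqrt s)" using s by (intro closure_ball) auto
    have "continuous_on (closure (ball 0 (sqrt s))) (\<lambda>u. F s u - F 1 u)"
      unfolding cl using s u by (intro continuous_intros contF continuous_on_subset[OF contF1]) auto
    then have "F s u - F 1 u = 0"
      by (rule continuous_constant_on_closure) (use inner s cl in auto)
    then show ?thesis using bdryF[of s u] s by simp
  qed
  show ?thesis
  proof (rule no_isolated_singularity)
    show "continuous_on (ball 0 1) \<phi>" by (rule continuous_on_subset[OF cont]) auto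
    have "(F 1 \<circ> uminus) holomorphic_on ball 0 1 - {0}"
      by (intro holomorphic_on_compose_gen[OF _ holF1] holomorphic_intros) auto
    then show "\<phi> holomorphic_on ball 0 1 - {0}"
      by (rule holomorphic_transform) (use outer[of "- _"] in \<open>simp add: less_imp_le\<close>)
  qed auto
qed

section \<open>Arbitrary centres\<close>

text \<open>A Moebius transformation moves \<open>\<alpha>\<close> to \<open>0\<close>, and a rotation then moves the other centre to a point \<open>t\<close> of
  the positive real axis.\<close>

theorem theorem1p3:
  fixes \<alpha> \<beta> :: complex and \<phi> :: "complex \<Rightarrow> complex"
  assumes "\<alpha> \<in> ball 0 1" and "\<beta> \<in> ball 0 1" and "\<alpha> \<noteq> \<beta>"
    and "continuous_on (cball 0 1) \<phi>"
    and "\<And>\<Gamma>. \<Gamma> \<in> circle_family \<alpha> \<union> circle_family \<beta> \<Longrightarrow> extends_holomorphically_from \<Gamma> \<phi>"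
  shows "\<phi> holomorphic_on ball 0 1"
proof -
  have \<alpha>: "norm \<alpha> < 1" and \<beta>: "norm \<beta> < 1" using assms(1,2) by auto
  obtain A where A: "circle_extensions (\<phi> \<circ> moebius \<alpha>) A"
    using circle_extensions_of_circle_family[OF \<alpha>] assms(5) by blast
  obtain B where B: "circle_extensions (\<phi> \<circ> moebius \<beta>) B"
    using circle_extensions_of_circle_family[OF \<beta>] assms(5) by blast
  \<comment> \<open>the centre \<open>\<beta>\<close> seen from \<open>\<alpha>\<close>, and its polar decomposition \<open>b = \<eta> * t\<close>\<close>
  define b where "b = moebius \<alpha> \<beta>"
  define t where "t = norm b"
  define \<eta> where "\<eta> = b / of_real t"
  have \<beta>_eq: "moebius \<alpha> b = \<beta>" unfolding b_def using \<alpha> \<beta> by (intro moebius_involution) auto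
  have "b \<noteq> 0" unfolding b_def using \<alpha> \<beta> assms(3) by (subst moebius_eq_0_iff) auto
  then have t0: "0 < t" by (simp add: t_def)
  have t1: "t < 1" unfolding t_def b_def using \<alpha> \<beta> by (subst norm_moebius_less_1_iff) auto
  have \<eta>: "norm \<eta> = 1" using t0 by (simp add: \<eta>_def norm_divide t_def)
  have b_eq: "b = \<eta> * of_real t" using t0 by (simp add: \<eta>_def)
  have \<eta>\<eta>: "\<eta> * cnj \<eta> = 1" using \<eta> by (simp add: complex_norm_square[symmetric])
  define \<psi> where "\<psi> z = \<phi> (moebius \<alpha> (\<eta> * z))" for z
  have cont\<psi>: "continuous_on (cball 0 1) \<psi>"
  proof -
    have "continuous_on (cball 0 1) (\<lambda>z. moebius \<alpha> (\<eta> * z))"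
      by (intro continuous_on_compose2[OF continuous_on_moebius[OF \<alpha>]] continuous_intros)
         (auto simp: norm_mult \<eta>)
    then show ?thesis
      unfolding \<psi>_def using norm_moebius_le_1[OF \<alpha>]
      by (intro continuous_on_compose2[OF assms(4)]) (auto simp: norm_mult \<eta>)
  qed
  have F: "circle_extensions (\<psi> \<circ> moebius 0) (\<lambda>s u. A s (- \<eta> * u))"
    by (rule circle_extensions_rotate[OF A]) (auto simp: \<eta> \<psi>_def moebius_def)
  \<comment> \<open>the rotation by which the parametrisations of the circles around \<open>\<beta>\<close> differ\<close>
  define \<mu> where "\<mu> = (1 - \<alpha> * cnj b) / (1 - cnj \<alpha> * b)"
  have b1: "norm b < 1" using t1 by (simp add: t_def)
  have \<mu>: "norm \<mu> = 1"
  proof -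
    have "1 - cnj \<alpha> * b \<noteq> 0" using \<alpha> b1 by (intro moebius_denominator_nonzero) auto
    moreover have "1 - \<alpha> * cnj b = cnj (1 - cnj \<alpha> * b)" by simp
    ultimately show ?thesis by (simp only: \<mu>_def norm_divide complex_mod_cnj) simp
  qed
  have H: "circle_extensions (\<psi> \<circ> moebius (of_real t)) (\<lambda>s u. B s (- \<mu> * \<eta> * u))"
  proof (rule circle_extensions_rotate[OF B])
    show "norm (- \<mu> * \<eta>) = 1" by (simp add: norm_mult \<mu> \<eta>)
    fix u :: complex assume u: "norm u \<le> 1"
    have "cnj b * (\<eta> * u) = of_real t * u"
      using \<eta>\<eta> by (simp add: b_eq mult_ac)
    then have "\<eta> * moebius (of_real t) u = moebius b (\<eta> * u)"
      by (simp add: moebius_def b_eq right_diff_distrib)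
    moreover have "moebius \<alpha> (moebius b (\<eta> * u)) = moebius \<beta> (- \<mu> * (\<eta> * u))"
      unfolding \<mu>_def \<beta>_eq[symmetric] using u by (intro moebius_compose \<alpha> b1) (simp add: norm_mult \<eta>)
    ultimately show "(\<psi> \<circ> moebius (of_real t)) u = (\<phi> \<circ> moebius \<beta>) (- \<mu> * \<eta> * u)"
      by (simp add: \<psi>_def mult.assoc)
  qed
  have hol: "\<psi> holomorphic_on ball 0 1"
    by (rule holomorphic_if_two_real_centres[OF cont\<psi> t0 t1 F H])
  have "(\<lambda>w. cnj \<eta> * moebius \<alpha> w) holomorphic_on ball 0 1"
    by (intro holomorphic_intros holomorphic_on_moebius \<alpha>)
  then have "(\<psi> \<circ> (\<lambda>w. cnj \<eta> * moebius \<alpha> w)) holomorphic_on ball 0 1"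
    by (rule holomorphic_on_compose_gen[OF _ hol])
       (auto simp: norm_mult \<eta> norm_moebius_less_1_iff[OF \<alpha>])
  then show ?thesis
  proof (rule holomorphic_transform)
    fix w :: complex assume "w \<in> ball 0 1"
    then show "(\<psi> \<circ> (\<lambda>w. cnj \<eta> * moebius \<alpha> w)) w = \<phi> w"
      using \<eta>\<eta> moebius_involution[OF \<alpha>, of w] by (simp add: \<psi>_def mult.assoc[symmetric])
  qed
qed

end
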